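(* The following two assertions hold, where $t=\cos(\beta\pi)$. (1) For every $s\in\mathbb{R}$ and every integer $n\ge2$, the set of $\beta\in(0,1)$ such that $(M_t^{(1-n)/2})^{-1}\in L\bigl(H^{s+1}(\mathbb{S}^n),H^{s}(\mathbb{S}^n)\bigr)$ has Lebesgue measure zero. Equivalently, for Lebesgue-almost every $\beta\in(0,1)$ the operator $(M_t^{(1-n)/2})^{-1}$ fails to be bounded from $H^{s+1}(\mathbb{S}^n)$ to $H^{s}(\mathbb{S}^n)$. (2) For every even integer $n\ge2$ and every $s\in\mathbb{R}$, the set of $\beta\in(0,1)$ such that $(M_t^{(3-n)/2})^{-1}\in L\bigl(H^{s+2}(\mathbb{S}^n),H^{s}(\mathbb{S}^n)\bigr)$ has Lebesgue measure zero. Equivalently, for Lebesgue-almost every $\beta\in(0,1)$ the operator $(M_t^{(3-n)/2})^{-1}$ fails to be bounded from $H^{s+2}(\mathbb{S}^n)$ to $H^{s}(\mathbb{S}^n)$.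
   Context: $\mathbb{S}^n\subset\mathbb{R}^{n+1}$ is the unit sphere, $\mathscr{H}_j$ ($j=0,1,2,\dots$) is the space of spherical harmonics of degree $j$, $P_j$ is the orthogonal projection of $L^2(\mathbb{S}^n)$ onto $\mathscr{H}_j$, and $-\Delta Y=j(j+n-1)Y$ for $Y\in\mathscr{H}_j$, where $\Delta$ is the Laplace--Beltrami operator. For $s\in\mathbb{R}$, $H^s(\mathbb{S}^n)$ is the $L^2$-based Sobolev space with norm $\|f\|_{H^s}=\|(1-\Delta)^{s/2}f\|_{L^2}$, i.e. $\|f\|_{H^s}^2=\sum_j (1+j(j+n-1))^s\|P_jf\|_{L^2}^2$. $L(X,Y)$ denotes the bounded linear operators from $X$ to $Y$. Generalized Minkowski--Funk transform (Rubin). For $t=\cos\theta\in(-1,1)$ and $\alpha>0$, $$(M_t^\alpha f)(x)=\frac{\kappa}{\Gamma(\alpha)}\int_{\{y\in\mathbb{S}^n:\ x\cdot y>t\}}(x\cdot y-t)^{\alpha-1}f(y)\,dy,$$ where $\kappa=\kappa(n,\alpha,t)\ne0$ is a normalizing constant whose value does not affect the claim; for other $\alpha\notin\{-\frac n2,-\frac n2-1,\dots\}$ it is defined by analytic continuation in $\alpha$. Equivalently, $M_t^\alpha$ is the spherical multiplier operator $M_t^\alpha f=\sum_{j\ge0}m_t^\alpha(j)P_jf$ with $$m_t^\alpha(j)=\kappa'\;{}_2F_1\Bigl(j+\tfrac n2,\;1-\tfrac n2-j;\;\alpha+\tfrac n2;\;\tfrac{1-t}{2}\Bigr),$$ where $\kappa'=\kappa'(n,\alpha,t)\neq0$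 does not depend on $j$ and ${}_2F_1$ is the Gauss hypergeometric function. The statement $(M_t^\alpha)^{-1}\in L(H^{\sigma}(\mathbb{S}^n),H^s(\mathbb{S}^n))$ means that $m_t^\alpha(j)\neq0$ for all $j$ and that there is $C>0$ such that the operator $(M_t^\alpha)^{-1}g=\sum_j m_t^\alpha(j)^{-1}P_jg$ satisfies $\|(M_t^\alpha)^{-1}g\|_{H^s}\le C\|g\|_{H^\sigma}$ for all finite sums $g$ of spherical harmonics. *)

theory Defs
  imports "HOL-Analysis.Analysis"
begin

text \<open>
  The ambient space of dimension \<open>n + 1\<close> is an arbitrary Euclidean space \<open>'a\<close>, so the sphere
  is \<open>sphere (0::'a) 1\<close> and \<open>n = sphere_dim TYPE('a)\<close>.
\<close>

definition sphere_dim :: "'a::euclidean_space itself \<Rightarrow> nat" where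
  "sphere_dim _ = DIM('a) - 1"

text \<open>
  By polar coordinates, the surface measure of \<open>A\<close> is \<open>n + 1\<close> times the Lebesgue measure of
  the cone of all \<open>r *\<^sub>R x\<close> with \<open>x \<in> A\<close> and \<open>0 < r \<le> 1\<close>.
\<close>

definition sphere_measure :: "'a::euclidean_space measure" where
  "sphere_measure =
     distr (scale_measure (of_nat DIM('a)) (restrict_space lborel (cball 0 1 - {0})))
       (restrict_space borel (sphere 0 1)) (\<lambda>x. x /\<^sub>R norm x)"

definition sphere_inner :: "('a::euclidean_space \<Rightarrow> complex) \<Rightarrow> ('a \<Rightarrow> complex) \<Rightarrow> complex" where
  "sphere_inner f g = (LINT x|sphere_measure. f x * cnj (g x))"

definition sphere_L2_norm :: "('a::euclidean_space \<Rightarrow> complex) \<Rightarrow> real" where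
  "sphere_L2_norm f = sqrt (LINT x|sphere_measure. (cmod (f x))\<^sup>2)"

definition euclidean_laplacian :: "('a::euclidean_space \<Rightarrow> complex) \<Rightarrow> 'a \<Rightarrow> complex" where
  "euclidean_laplacian p x =
     (\<Sum>b\<in>Basis. frechet_derivative (\<lambda>y. frechet_derivative p (at y) b) (at x) b)"

text \<open>
  Spherical harmonics of degree \<open>j\<close>: restrictions to the sphere of homogeneous harmonic
  polynomials of degree \<open>j\<close>. Functions on the sphere are functions on \<open>'a\<close>; the value \<open>0\<close> off
  the sphere makes the representation of each spherical harmonic unique.
\<close>

definition spherical_harmonics :: "nat \<Rightarrow> ('a::euclidean_space \<Rightarrow> complex) set" where
  "spherical_harmonics j =
     {(\<lambda>x. if x \<in> sphere 0 1 then p x else 0) | p.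
        polynomial_function p \<and>
        (\<forall>c x. p (c *\<^sub>R x) = c ^ j *\<^sub>R p x) \<and>
        (\<forall>x. euclidean_laplacian p x = 0)}"

definition finite_harmonic_sums :: "('a::euclidean_space \<Rightarrow> complex) set" where
  "finite_harmonic_sums =
     {(\<lambda>x. \<Sum>j\<le>N. Y j x) | N Y. \<forall>j. Y j \<in> spherical_harmonics j}"

text \<open>
  The orthogonal projection onto \<open>spherical_harmonics j\<close>, characterized by orthogonality of the
  residual; it is well defined for functions that are square integrable on the sphere.
\<close>

definition harmonic_projection ::
    "nat \<Rightarrow> ('a::euclidean_space \<Rightarrow> complex) \<Rightarrow> 'a \<Rightarrow> complex" where
  "harmonic_projection j f =
     (THE h. h \<in> spherical_harmonics j \<and>
        (\<forall>Y\<in>spherical_harmonics j. sphere_inner (\<lambda>x. f x - h x) Y = 0))"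

text \<open>
  The two infinite sums below are only meaningful when they converge; for
  \<open>f \<in> finite_harmonic_sums\<close> they have finitely many nonzero terms.
\<close>

definition sobolev_norm :: "real \<Rightarrow> ('a::euclidean_space \<Rightarrow> complex) \<Rightarrow> real" where
  "sobolev_norm s f =
     sqrt (\<Sum>j. (1 + real j * (real j + real (sphere_dim TYPE('a)) - 1)) powr s *
                (sphere_L2_norm (harmonic_projection j f))\<^sup>2)"

definition spherical_multiplier ::
    "(nat \<Rightarrow> real) \<Rightarrow> ('a::euclidean_space \<Rightarrow> complex) \<Rightarrow> 'a \<Rightarrow> complex" where
  "spherical_multiplier \<mu> f = (\<lambda>x. \<Sum>j. \<mu> j *\<^sub>R harmonic_projection j f x)"

text \<open>The Gauss hypergeometric series, convergent for \<open>\<bar>z\<bar> < 1\<close>.\<close>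

definition gauss_hypergeo :: "real \<Rightarrow> real \<Rightarrow> real \<Rightarrow> real \<Rightarrow> real" where
  "gauss_hypergeo a b c z = eval_fps (fps_hypergeo [a, b] [c] 1) z"

text \<open>
  The eigenvalue on \<open>spherical_harmonics j\<close> of the generalized Minkowski--Funk transform of order
  \<open>\<alpha>\<close> on the \<open>n\<close>-sphere. It is given in the closed form that is valid for every \<open>\<alpha>\<close> reached by
  analytic continuation, i.e. \<open>\<alpha> \<notin> {-n/2, -n/2 - 1, \<dots>}\<close>, and \<open>-1 < t < 1\<close>.
  The nonzero normalizing constant \<open>\<kappa> \<alpha> t\<close> is a parameter.
\<close>

definition minkowski_funk_eigenvalue ::
    "(real \<Rightarrow> real \<Rightarrow> real) \<Rightarrow> nat \<Rightarrow> real \<Rightarrow> real \<Rightarrow> nat \<Rightarrow> real" where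
  "minkowski_funk_eigenvalue \<kappa> n \<alpha> t j =
     \<kappa> \<alpha> t * gauss_hypergeo (real j + real n / 2) (1 - real n / 2 - real j)
                            (\<alpha> + real n / 2) ((1 - t) / 2)"

definition minkowski_funk ::
    "(real \<Rightarrow> real \<Rightarrow> real) \<Rightarrow> real \<Rightarrow> real \<Rightarrow>
      ('a::euclidean_space \<Rightarrow> complex) \<Rightarrow> 'a \<Rightarrow> complex" where
  "minkowski_funk \<kappa> \<alpha> t =
     spherical_multiplier (minkowski_funk_eigenvalue \<kappa> (sphere_dim TYPE('a)) \<alpha> t)"

definition minkowski_funk_inverse ::
    "(real \<Rightarrow> real \<Rightarrow> real) \<Rightarrow> real \<Rightarrow> real \<Rightarrow>
      ('a::euclidean_space \<Rightarrow> complex) \<Rightarrow> 'a \<Rightarrow> complex" where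
  "minkowski_funk_inverse \<kappa> \<alpha> t =
     spherical_multiplier
       (\<lambda>j. inverse (minkowski_funk_eigenvalue \<kappa> (sphere_dim TYPE('a)) \<alpha> t j))"

text \<open>
  The inverse of the transform exists and extends to a bounded operator from the Sobolev space
  of order \<open>\<sigma>\<close> to the one of order \<open>s\<close>; the finite sums of spherical harmonics are dense in both.
\<close>

definition minkowski_funk_inverse_bounded ::
    "'a::euclidean_space itself \<Rightarrow> (real \<Rightarrow> real \<Rightarrow> real) \<Rightarrow>
      real \<Rightarrow> real \<Rightarrow> real \<Rightarrow> real \<Rightarrow> bool" where
  "minkowski_funk_inverse_bounded _ \<kappa> \<alpha> t \<sigma> s \<longleftrightarrow>
     (\<forall>j. minkowski_funk_eigenvalue \<kappa> (sphere_dim TYPE('a)) \<alpha> t j \<noteq> 0) \<and>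
     (\<exists>C>0. \<forall>g\<in>(finite_harmonic_sums :: ('a \<Rightarrow> complex) set).
        sobolev_norm s (minkowski_funk_inverse \<kappa> \<alpha> t g) \<le> C * sobolev_norm \<sigma> g)"

end

theory Submission
  imports Defs "HOL-Real_Asymp.Real_Asymp"
begin

text \<open>
  For the two orders \<open>\<alpha> = (1 - n) / 2\<close> and \<open>\<alpha> = (3 - n) / 2\<close> the hypergeometric function in the
  eigenvalue is elementary. With \<open>q = 2 * j + n - 1\<close> the eigenvalue on spherical harmonics of degree
  \<open>j\<close> is, up to a factor independent of \<open>j\<close>, equal to \<open>cos (q * \<beta> * pi / 2)\<close> in the first case and to
  \<open>sin (q * \<beta> * pi / 2) / q\<close> in the second (\<open>minkowski_funk_eigenvalue_cos\<close> and
  \<open>minkowski_funk_eigenvalue_sin\<close>).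

  Spherical harmonics of different degrees are orthogonal, so a bound for the inverse operator tested
  on one spherical harmonic of each degree is a lower bound for the eigenvalues
  (\<open>minkowski_funk_inverse_bounded_imp_eigenvalue_bound\<close>). For the Sobolev indices of the theorem it
  says that the cosine, respectively the sine, is at least of order \<open>1 / q\<close>. The zeros of the
  trigonometric functions turn this into \<open>\<bar>q * \<beta> - p\<bar> \<ge> c / q\<close> for all \<open>q \<ge> n - 1\<close> with the parity of
  \<open>n - 1\<close> and all \<open>p\<close> that are odd (first case) or even (second case): \<open>\<beta>\<close> is badly approximable by
  fractions of a given parity type.

  Such numbers form a null set (\<open>negligible_badly_approximable_of_given_parity\<close>) unless numerator and
  denominator are both required to be even, which explains why the second assertion is about even \<open>n\<close>.
  Indeed every irrational number has infinitely many approximations of quality \<open>12 / q\<close> of each of the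
  other three parity types, and the set of those \<open>\<beta>\<close> that admit a fixed \<open>c\<close> avoids a fixed proportion
  of the small intervals around each of its points that these approximations provide.
\<close>

section \<open>Approximation by fractions of a given parity\<close>

text \<open>
  A substitute for the Lebesgue density theorem: a set of positive measure cannot lose a fixed
  proportion of arbitrarily small balls around each of its points. Enclose \<open>S\<close> in an open set
  only slightly larger than \<open>S\<close>, cover \<open>S\<close> by disjoint such balls inside it (Vitali), and add up:
  \<open>S\<close> then has less measure than itself.
\<close>

lemma negligible_if_uniformly_porous:
  fixes S :: "'a::euclidean_space set"
  assumes S: "S \<in> lmeasurable" and \<delta>: "0 < \<delta>" "\<delta> < 1"
    and porous: "\<And>x d. x \<in> S \<Longrightarrow> 0 < d \<Longrightarrow>
      \<exists>r. 0 < r \<and> r < d \<and> measure lebesgue (S \<inter> cball x r) \<le> (1 - \<delta>) * measure lebesgue (cball x r)"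
  shows "negligible S"
proof (rule ccontr)
  assume "\<not> negligible S"
  define m where "m = measure lebesgue S"
  have m: "m > 0"
    using S \<open>\<not> negligible S\<close> negligible_iff_measure[of S]
    by (simp add: m_def zero_less_measure_iff)
  \<comment> \<open>The excess \<open>\<delta> * m\<close> is small enough because \<open>(1 - \<delta>) * (m + \<delta> * m) < m\<close>.\<close>
  obtain U where U: "open U" "S \<subseteq> U" "U \<in> lmeasurable" "measure lebesgue U < m + \<delta> * m"
  proof -
    obtain U where U: "open U" "S \<subseteq> U" "U - S \<in> lmeasurable" "emeasure lebesgue (U - S) < ennreal (\<delta> * m)"
      using sets_lebesgue_outer_open[of S "\<delta> * m"] S m \<delta> by auto
    have "U = S \<union> (U - S)" using U by blast
    then have "U \<in> lmeasurable"
      using S U(3) by (metis fmeasurable.Un)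
    then have "measure lebesgue (U - S) = measure lebesgue U - m"
      using S U(2) by (simp add: m_def measurable_measure_Diff)
    moreover have "measure lebesgue (U - S) < \<delta> * m"
      using U m \<delta> by (simp add: emeasure_eq_measure2 ennreal_less_iff)
    ultimately show ?thesis using that[OF U(1,2)] \<open>U \<in> lmeasurable\<close> by linarith
  qed
  define K where "K = {(x, r). x \<in> S \<and> 0 < r \<and> cball x r \<subseteq> U \<and>
      measure lebesgue (S \<inter> cball x r) \<le> (1 - \<delta>) * measure lebesgue (cball x r)}"
  have fine: "\<exists>i. i \<in> K \<and> x \<in> cball (fst i) (snd i) \<and> snd i < d" if "x \<in> S" "0 < d" for x d
  proof -
    have "x \<in> U"
      using U(2) that(1) by (rule subsetD)
    then obtain e where e: "e > 0" "cball x e \<subseteq> U"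
      using U(1) by (metis open_contains_cball)
    have "0 < min d e" using that(2) e(1) by simp
    from porous[OF that(1) this] obtain r where r: "0 < r" "r < min d e"
      "measure lebesgue (S \<inter> cball x r) \<le> (1 - \<delta>) * measure lebesgue (cball x r)"
      by blast
    have "cball x r \<subseteq> cball x e"
      using r by (intro subset_cball) auto
    then have "(x, r) \<in> K"
      using r e that by (auto simp: K_def)
    then show ?thesis
      using r by (intro exI[of _ "(x, r)"]) auto
  qed
  have Kpos: "0 < snd i" if "i \<in> K" for i
    using that by (auto simp: K_def)
  obtain C where C: "countable C" "C \<subseteq> K"
     "pairwise (\<lambda>i j. disjnt (cball (fst i) (snd i)) (cball (fst j) (snd j))) C"
     "negligible (S - (\<Union>i \<in> C. cball (fst i) (snd i)))"
    using Vitali_covering_theorem_cballs[OF Kpos fine] by blast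
  let ?B = "\<lambda>i. cball (fst i) (snd i)"
  have disj: "disjoint_family_on ?B C"
    using C(3) by (auto simp: disjoint_family_on_def pairwise_def disjnt_def)
  then have disjS: "disjoint_family_on (\<lambda>i. S \<inter> ?B i) C"
    unfolding disjoint_family_on_def by blast
  have Ssets: "S \<in> sets lebesgue" using S by auto
  have UB: "(\<Union>i\<in>C. ?B i) \<in> sets lebesgue"
    using C(1) by (intro sets.countable_UN') auto
  have USB: "(\<Union>i\<in>C. S \<inter> ?B i) \<in> sets lebesgue"
    using C(1) Ssets by (intro sets.countable_UN') auto
  have "emeasure lebesgue S \<le> emeasure lebesgue ((S - (\<Union>i\<in>C. ?B i)) \<union> (\<Union>i\<in>C. S \<inter> ?B i))"
    using UB USB Ssets by (intro emeasure_mono sets.Un sets.Diff) auto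
  also have "\<dots> \<le> emeasure lebesgue (S - (\<Union>i\<in>C. ?B i)) + emeasure lebesgue (\<Union>i\<in>C. S \<inter> ?B i)"
    using UB USB Ssets by (intro emeasure_subadditive sets.Diff)
  also have "emeasure lebesgue (S - (\<Union>i\<in>C. ?B i)) = 0"
    using C(4) by (simp only: negligible_iff_null_sets null_setsD1)
  also have "emeasure lebesgue (\<Union>i\<in>C. S \<inter> ?B i) = (\<integral>\<^sup>+i. emeasure lebesgue (S \<inter> ?B i) \<partial>count_space C)"
    using C(1) disjS Ssets by (intro emeasure_UN_countable) auto
  also have "\<dots> \<le> (\<integral>\<^sup>+i. ennreal (1 - \<delta>) * emeasure lebesgue (?B i) \<partial>count_space C)"
  proof (intro nn_integral_mono)
    fix i assume "i \<in> space (count_space C)"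
    then have "measure lebesgue (S \<inter> ?B i) \<le> (1 - \<delta>) * measure lebesgue (?B i)"
      using C(2) by (auto simp: K_def)
    moreover have "S \<inter> ?B i \<in> lmeasurable"
      using S by (intro fmeasurable.Int) auto
    ultimately show "emeasure lebesgue (S \<inter> ?B i) \<le> ennreal (1 - \<delta>) * emeasure lebesgue (?B i)"
      using \<delta> by (simp add: emeasure_eq_measure2 ennreal_mult[symmetric])
  qed
  also have "\<dots> = ennreal (1 - \<delta>) * (\<integral>\<^sup>+i. emeasure lebesgue (?B i) \<partial>count_space C)"
    by (rule nn_integral_cmult) auto
  also have "(\<integral>\<^sup>+i. emeasure lebesgue (?B i) \<partial>count_space C) = emeasure lebesgue (\<Union>i\<in>C. ?B i)"
    using C(1) disj by (intro emeasure_UN_countable[symmetric]) auto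
  also have "\<dots> \<le> emeasure lebesgue U"
  proof (intro emeasure_mono UN_least)
    fix i assume "i \<in> C"
    then have "i \<in> K" using C(2) by blast
    then show "?B i \<subseteq> U" by (simp add: K_def case_prod_beta)
  qed (use U(3) in blast)
  also have "0 + ennreal (1 - \<delta>) * emeasure lebesgue U = ennreal ((1 - \<delta>) * measure lebesgue U)"
    using U \<delta> by (simp add: emeasure_eq_measure2 ennreal_mult)
  finally have "m \<le> (1 - \<delta>) * measure lebesgue U"
    using S \<delta> by (simp add: emeasure_eq_measure2 m_def mult_left_mono)
  also have "\<dots> < (1 - \<delta>) * (m + \<delta> * m)"
    using U \<delta> by (intro mult_strict_left_mono) auto
  also have "\<dots> = m - \<delta> * \<delta> * m"
    by (simp add: algebra_simps)
  also have "\<dots> < m"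
    using \<delta> m by simp
  finally show False .
qed

text \<open>
  The denominators are unbounded: for irrational \<open>\<beta>\<close> the distances of \<open>q * \<beta>\<close> to the integers with
  \<open>0 < q \<le> Q\<close> have a positive minimum, and Dirichlet's theorem with an accuracy below that minimum
  has to produce a larger \<open>q\<close>.
\<close>

lemma Dirichlet_approx_coprime_large:
  fixes \<beta> :: real and Q :: nat
  assumes "\<beta> \<notin> \<rat>"
  obtains p q :: int where "coprime p q" "int Q \<le> q" "0 < q" "\<bar>of_int q * \<beta> - of_int p\<bar> < 1 / q"
proof -
  have pos: "\<bar>of_int q * \<beta> - of_int p\<bar> > 0" if "q > 0" for p q :: int
  proof (rule ccontr)
    assume "\<not> ?thesis"
    then have "\<beta> = of_int p / of_int q" using that by (simp add: field_simps)
    then show False using assms by simp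
  qed
  define E where "E = (\<lambda>q::int. \<bar>of_int q * \<beta> - of_int (round (of_int q * \<beta>))\<bar>) ` {0<..int Q}"
  obtain N :: nat where N: "N > 0" "\<And>e. e \<in> E \<Longrightarrow> 1 / N \<le> e"
  proof -
    have "finite (insert 1 E)" by (auto simp: E_def)
    moreover have "\<forall>e \<in> insert 1 E. e > 0" using pos by (auto simp: E_def)
    ultimately have "Min (insert 1 E) > 0" by (subst Min_gr_iff) auto
    then obtain N where N: "inverse (real (Suc N)) < Min (insert 1 E)"
      using reals_Archimedean by blast
    have "1 / real (Suc N) \<le> e" if "e \<in> E" for e
    proof -
      have "Min (insert 1 E) \<le> e" using \<open>finite (insert 1 E)\<close> that by (intro Min_le) auto
      with N show ?thesis by (simp add: inverse_eq_divide)
    qed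
    then show ?thesis by (intro that[of "Suc N"]) auto
  qed
  obtain p q where pq: "coprime p q" "0 < q" "q \<le> int N" "\<bar>of_int q * \<beta> - of_int p\<bar> < 1 / N"
    using Dirichlet_approx_coprime[OF N(1)] by blast
  have "int Q \<le> q"
  proof (rule ccontr)
    assume "\<not> int Q \<le> q"
    then have "1 / N \<le> \<bar>of_int q * \<beta> - of_int (round (of_int q * \<beta>))\<bar>"
      using pq by (intro N) (auto simp: E_def)
    also have "\<dots> \<le> \<bar>of_int q * \<beta> - of_int p\<bar>"
      by (metis abs_minus_commute round_diff_minimal)
    finally show False using pq by simp
  qed
  moreover have "1 / real N \<le> 1 / q"
    using pq by (simp add: field_simps)
  ultimately show ?thesis using that pq by force
qed

text \<open>
  Complete a coprime approximation \<open>(p, q)\<close> to a basis of the integer lattice by a second vector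
  \<open>(p', q')\<close> with \<open>q \<le> q' < 2 * q\<close>; the determinant being \<open>1\<close>, the second fraction is almost as
  good an approximation as the first. A basis stays a basis modulo \<open>2\<close>, so the three vectors
  \<open>(p, q)\<close>, \<open>(p', q')\<close> and \<open>(p + p', q + q')\<close> represent the three nonzero parity classes.
\<close>

lemma infinitely_many_approximations_of_given_parity:
  fixes \<beta> :: real and Q :: nat and u v :: int
  assumes "\<beta> \<notin> \<rat>" and uv: "odd u \<or> odd v"
  obtains p q :: int where "int Q \<le> q" "0 < q" "even p \<longleftrightarrow> even u" "even q \<longleftrightarrow> even v"
    "\<bar>of_int q * \<beta> - of_int p\<bar> \<le> 12 / q"
proof -
  obtain p q :: int where pq: "coprime p q" "int Q \<le> q" "0 < q" "\<bar>of_int q * \<beta> - of_int p\<bar> < 1 / q"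
    using Dirichlet_approx_coprime_large[OF assms(1)] by blast
  obtain a b where ab: "a * p + b * q = 1"
    using pq(1) by (metis bezout_int coprime_imp_gcd_eq_1)
  \<comment> \<open>Subtracting multiples of \<open>(p, q)\<close> from the Bezout solution moves the denominator into \<open>{q..<2 * q}\<close>.\<close>
  define q' where "q' = a mod q + q"
  define p' where "p' = - b - p * (a div q) + p"
  have q': "q \<le> q'" "q' < 2 * q" using pq by (auto simp: q'_def)
  have det: "q' * p - p' * q = 1"
  proof -
    have "q' = a - q * (a div q) + q"
      by (simp add: q'_def minus_mult_div_eq_mod)
    then have "q' * p - p' * q = a * p + b * q" by (simp only: p'_def) (simp add: algebra_simps)
    then show ?thesis using ab by simp
  qed
  define \<epsilon> where "\<epsilon> = of_int q * \<beta> - of_int p"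
  define \<epsilon>' where "\<epsilon>' = of_int q' * \<beta> - of_int p'"
  have e: "\<bar>\<epsilon>\<bar> \<le> 1 / q" using pq by (simp add: \<epsilon>_def)
  have "q * \<epsilon>' = q' * \<epsilon> + 1"
  proof -
    have "q * \<epsilon>' - q' * \<epsilon> = of_int (q' * p - p' * q)"
      by (simp add: \<epsilon>_def \<epsilon>'_def algebra_simps)
    then show ?thesis by (simp add: det)
  qed
  then have "\<epsilon>' = (q' / q) * \<epsilon> + 1 / q" using pq by (simp add: field_simps)
  then have "\<bar>\<epsilon>'\<bar> \<le> (q' / q) * \<bar>\<epsilon>\<bar> + 1 / q"
    using pq q' by (auto simp: abs_mult intro: order.trans[OF abs_triangle_ineq])
  also have "(q' / q) * \<bar>\<epsilon>\<bar> \<le> 2 * (1 / q)"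
    using pq q' e by (intro mult_mono) (auto simp: field_simps)
  finally have e': "\<bar>\<epsilon>'\<bar> \<le> 3 / q" by simp
  have par: "odd (q' * p - p' * q)" by (simp add: det)
  consider "even p = even u \<and> even q = even v" | "even p' = even u \<and> even q' = even v"
    | "even (p + p') = even u \<and> even (q + q') = even v"
    using par uv by auto
  then show ?thesis
  proof cases
    case 1
    have "1 / real_of_int q \<le> 12 / q" using pq by (intro divide_right_mono) auto
    with 1 e pq show ?thesis by (intro that[of q p]) (auto simp: \<epsilon>_def)
  next
    case 2
    have "3 / real_of_int q \<le> 12 / q'" using pq q' by (auto simp: field_simps)
    with 2 e' pq q' show ?thesis by (intro that[of q' p']) (auto simp: \<epsilon>'_def)
  next
    case 3
    have "of_int (q + q') * \<beta> - of_int (p + p') = \<epsilon> + \<epsilon>'"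
      by (simp add: \<epsilon>_def \<epsilon>'_def algebra_simps)
    also have "\<bar>\<dots>\<bar> \<le> 4 / q" using e e' by (intro order.trans[OF abs_triangle_ineq]) auto
    also have "\<dots> \<le> 12 / of_int (q + q')" using pq q' by (auto simp: field_simps)
    finally show ?thesis using 3 pq q' by (intro that[of "q + q'" "p + p'"]) auto
  qed
qed

text \<open>
  The integers \<open>u\<close> and \<open>v\<close> only stand for their parities. The lower bound \<open>Q\<close> is there because just
  the denominators \<open>q = 2 * j + n - 1\<close> with \<open>j \<ge> 0\<close> come from eigenvalues.
\<close>

definition badly_approximable_of_parity :: "nat \<Rightarrow> int \<Rightarrow> int \<Rightarrow> real set" where
  "badly_approximable_of_parity Q u v = {\<beta>. \<exists>c>0. \<forall>p q::int. int Q \<le> q \<and> 0 < q \<and>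
      (even p \<longleftrightarrow> even u) \<and> (even q \<longleftrightarrow> even v) \<longrightarrow> c / q \<le> \<bar>of_int q * \<beta> - of_int p\<bar>}"

text \<open>
  The part \<open>S\<close> of the set that belongs to a fixed constant \<open>c\<close> avoids the ball of radius
  \<open>c / q\<^sup>2\<close> around each admissible fraction \<open>p / q\<close>. Each irrational point lies within
  \<open>12 / q\<^sup>2\<close> of such fractions with arbitrarily large \<open>q\<close>, so \<open>S\<close> misses the proportion
  \<open>c / (12 + c)\<close> of the ball of radius \<open>(12 + c) / q\<^sup>2\<close> around it.
\<close>

lemma negligible_badly_approximable_of_given_parity:
  fixes Q :: nat and u v :: int
  assumes uv: "odd u \<or> odd v"
  shows "negligible (badly_approximable_of_parity Q u v)"
proof -
  define G where "G = {(p :: int, q :: int). int Q \<le> q \<and> 0 < q \<and> (even p \<longleftrightarrow> even u) \<and> (even q \<longleftrightarrow> even v)}"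
  define A where "A c = (\<Inter>(p,q)\<in>G. {\<beta>::real. c / of_int q \<le> \<bar>of_int q * \<beta> - of_int p\<bar>})" for c :: real
  \<comment> \<open>Cutting down to bounded pieces keeps the measures finite, and it suffices to take \<open>c = 1, 1 / 2, 1 / 3, \<dots>\<close>.\<close>
  define S where "S k l = A (inverse (real (Suc k))) \<inter> cball 0 (real l) - \<rat>" for k l :: nat
  have Rats: "negligible (\<rat> :: real set)"
    by (simp add: negligible_iff_null_sets null_sets_completionI countable_imp_null_set_lborel countable_rat)
  have "closed (A c)" for c
    unfolding A_def by (intro closed_INT ballI) (auto intro!: closed_Collect_le continuous_intros)
  then have S_meas: "S k l \<in> lmeasurable" for k l
  proof -
    have "compact (A (inverse (real (Suc k))) \<inter> cball 0 (real l))"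
      using \<open>\<And>c. closed (A c)\<close> by (simp add: closed_Int_compact)
    then show ?thesis
      unfolding S_def by (intro fmeasurable_Diff lmeasurable_compact)
        (use Rats in \<open>auto simp: negligible_iff_null_sets fmeasurableI_null_sets\<close>)
  qed
  have negl: "negligible (S k l)" for k l
  proof -
    define c where "c = inverse (real (Suc k))"
    have c: "0 < c" "c \<le> 1" by (auto simp: c_def divide_simps)
    have "\<exists>r. 0 < r \<and> r < d \<and>
        measure lebesgue (S k l \<inter> cball x r) \<le> (1 - c / (12 + c)) * measure lebesgue (cball x r)"
      if xd: "x \<in> S k l" "0 < d" for x d
    proof -
      \<comment> \<open>Since \<open>c \<le> 1\<close>, the radius \<open>(12 + c) / q\<^sup>2\<close> used below is at most \<open>13 / q\<close>.\<close>
      obtain M :: nat where M: "M > 0" "13 / M < d"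
      proof -
        obtain M :: nat where M: "13 / d < M" using reals_Archimedean2 by blast
        moreover have "0 < 13 / d" using xd by simp
        ultimately have "0 < real M" by linarith
        then show ?thesis using M xd by (intro that[of M]) (auto simp: field_simps)
      qed
      have "x \<notin> \<rat>" using xd by (auto simp: S_def)
      then obtain p q :: int where pq: "int (max Q M) \<le> q" "0 < q" "even p \<longleftrightarrow> even u" "even q \<longleftrightarrow> even v"
          "\<bar>of_int q * x - of_int p\<bar> \<le> 12 / q"
        using infinitely_many_approximations_of_given_parity[OF _ uv] by metis
      have G: "(p, q) \<in> G" using pq by (auto simp: G_def)
      define r where "r = (12 + c) / q\<^sup>2"
      define y where "y = p / q"
      have qM: "real M \<le> q" "1 \<le> real_of_int q" using pq by linarith+
      have "r \<le> 13 / q\<^sup>2" using c by (auto simp: r_def intro!: divide_right_mono)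
      also have "\<dots> \<le> 13 / q" using qM by (auto intro!: divide_left_mono simp: power2_eq_square)
      also have "\<dots> \<le> 13 / M" using qM M by (auto intro!: divide_left_mono)
      finally have "r < d" using M by simp
      have "r > 0" using c qM by (auto simp: r_def)
      have "x - y = (q * x - p) / q" using qM by (simp add: y_def field_simps)
      then have "\<bar>x - y\<bar> = \<bar>q * x - p\<bar> / q" using qM by simp
      also have "\<dots> \<le> (12 / q) / q" using pq qM by (intro divide_right_mono) auto
      finally have "\<bar>x - y\<bar> \<le> 12 / q\<^sup>2" by (simp add: power2_eq_square)
      then have sub: "ball y (c / q\<^sup>2) \<subseteq> cball x r"
        by (auto simp: r_def dist_real_def add_divide_distrib)
      have "S k l \<inter> ball y (c / q\<^sup>2) = {}"
      proof -
        have "z \<notin> S k l" if "z \<in> ball y (c / q\<^sup>2)" for z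
        proof
          assume "z \<in> S k l"
          then have "c / q \<le> \<bar>q * z - p\<bar>" using G by (auto simp: S_def A_def c_def)
          moreover have "q * z - p = - q * (y - z)" using qM by (simp add: y_def field_simps)
          ultimately have "c / q \<le> q * \<bar>y - z\<bar>" using qM by (simp add: abs_mult)
          moreover have "q * \<bar>y - z\<bar> < q * (c / q\<^sup>2)"
            using that qM by (intro mult_strict_left_mono) (auto simp: dist_real_def)
          ultimately show False using qM by (simp add: power2_eq_square)
        qed
        then show ?thesis by blast
      qed
      then have "measure lebesgue (S k l \<inter> cball x r) \<le> measure lebesgue (cball x r - ball y (c / q\<^sup>2))"
        using S_meas by (intro measure_mono_fmeasurable) (auto intro!: fmeasurable_Diff fmeasurableD)
      also have "\<dots> = measure lebesgue (cball x r) - measure lebesgue (ball y (c / q\<^sup>2))"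
        using sub by (intro measurable_measure_Diff) auto
      also have "\<dots> = 2 * r - 2 * (c / q\<^sup>2)"
        using c \<open>r > 0\<close> by (simp add: cball_eq_atLeastAtMost ball_eq_greaterThanLessThan)
      also have "\<dots> = (1 - c / (12 + c)) * (2 * r)"
      proof -
        have "(1 - c / (12 + c)) * (2 * r) = 2 * ((12 + c) * (1 - c / (12 + c))) / q\<^sup>2"
          by (simp add: r_def)
        also have "(12 + c) * (1 - c / (12 + c)) = 12" using c by (simp add: field_simps)
        finally show ?thesis by (simp add: r_def add_divide_distrib)
      qed
      also have "2 * r = measure lebesgue (cball x r)"
        using \<open>r > 0\<close> by (simp add: cball_eq_atLeastAtMost)
      finally show ?thesis using \<open>r < d\<close> \<open>r > 0\<close> by blast
    qed
    then show ?thesis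
      using c by (intro negligible_if_uniformly_porous[OF S_meas, of "c / (12 + c)"]) auto
  qed
  have "badly_approximable_of_parity Q u v \<subseteq> \<rat> \<union> (\<Union>k. \<Union>l. S k l)"
    unfolding badly_approximable_of_parity_def
  proof safe
    fix \<beta> c :: real
    assume c: "c > 0" and *: "\<forall>p q::int. int Q \<le> q \<and> 0 < q \<and> (even p \<longleftrightarrow> even u) \<and> (even q \<longleftrightarrow> even v)
           \<longrightarrow> c / q \<le> \<bar>of_int q * \<beta> - of_int p\<bar>" and "\<beta> \<notin> (\<Union>k. \<Union>l. S k l)"
    obtain k where k: "inverse (real (Suc k)) < c" using reals_Archimedean c by blast
    obtain l where l: "\<bar>\<beta>\<bar> \<le> real l" using real_arch_simple by blast
    have "inverse (real (Suc k)) / q \<le> \<bar>of_int q * \<beta> - of_int p\<bar>" if "(p, q) \<in> G" for p q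
    proof -
      have "inverse (real (Suc k)) / q \<le> c / q"
        using k that by (intro divide_right_mono) (auto simp: G_def)
      moreover have "c / q \<le> \<bar>of_int q * \<beta> - of_int p\<bar>"
        using that by (intro *[rule_format]) (simp add: G_def)
      ultimately show ?thesis by linarith
    qed
    then have "\<beta> \<in> A (inverse (real (Suc k)))" by (auto simp: A_def)
    moreover have "\<beta> \<notin> S k l" using \<open>\<beta> \<notin> (\<Union>k. \<Union>l. S k l)\<close> by blast
    ultimately show "\<beta> \<in> \<rat>"
      using l by (auto simp: S_def)
  qed
  moreover have "negligible (\<rat> \<union> (\<Union>k. \<Union>l. S k l) :: real set)"
    using negl by (intro negligible_Un negligible_countable_Union Rats) auto
  ultimately show ?thesis by (rule negligible_subset[rotated])
qed

section \<open>Elementary cases of the hypergeometric function\<close>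

text \<open>
  The ratio of consecutive coefficients tends to \<open>1\<close>. It is used as a bound on the next coefficient
  rather than as a quotient because the series terminates when \<open>a\<close> or \<open>b\<close> is a nonpositive integer.
\<close>

lemma fps_conv_radius_hypergeo_2_1:
  fixes a b c :: real
  shows "fps_conv_radius (fps_hypergeo [a, b] [c] 1) \<ge> 1"
proof -
  let ?F = "fps_nth (fps_hypergeo [a, b] [c] 1)"
  have "conv_radius ?F \<ge> 1"
  proof (rule conv_radius_geI_ex)
    fix r :: real assume r: "0 < r" "ereal r < 1"
    define g where "g n = ((a + n) * (b + n)) / ((c + n) * Suc n)" for n :: nat
    have rec: "?F (Suc n) = g n * ?F n" for n
      by (simp add: fps_hypergeo_rec g_def mult_ac del: fps_hypergeo_nth)
    have "g \<longlonglongrightarrow> 1"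
      unfolding g_def by real_asymp
    then have "(\<lambda>n. norm (g n) * r) \<longlonglongrightarrow> norm (1::real) * r"
      by (intro tendsto_intros)
    moreover obtain r' where r': "r < r'" "r' < 1"
      using dense[of r 1] r by auto
    ultimately have "eventually (\<lambda>n. norm (g n) * r < r') sequentially"
      by (intro order_tendstoD) auto
    then obtain N where N: "\<And>n. n \<ge> N \<Longrightarrow> norm (g n) * r < r'"
      by (auto simp: eventually_sequentially)
    have "summable (\<lambda>n. ?F n * r ^ n)"
    proof (rule summable_ratio_test[OF r'(2), of N])
      fix n assume "n \<ge> N"
      have "norm (?F (Suc n) * r ^ Suc n) = (norm (g n) * r) * norm (?F n * r ^ n)"
        using r by (simp only: rec norm_mult power_Suc) simp
      also have "\<dots> \<le> r' * norm (?F n * r ^ n)"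
        using N[OF \<open>n \<ge> N\<close>] by (intro mult_right_mono) auto
      finally show "norm (?F (Suc n) * r ^ Suc n) \<le> r' * norm (?F n * r ^ n)" .
    qed
    then show "\<exists>z. norm z = r \<and> summable (\<lambda>n. ?F n * z ^ n)"
      using r by (intro exI[of _ r]) auto
  qed
  then show ?thesis by (simp add: fps_conv_radius_def)
qed

text \<open>
  Gauss's hypergeometric differential equation; comparing coefficients it is the recurrence of the
  coefficients.
\<close>

lemma fps_hypergeo_2_1_ode:
  fixes a b c :: real
  assumes c: "c \<notin> \<int>\<^sub>\<le>\<^sub>0"
  defines "F \<equiv> fps_hypergeo [a, b] [c] 1"
  shows "fps_X * (1 - fps_X) * fps_deriv (fps_deriv F) + (fps_const c - fps_const (a + b + 1) * fps_X) * fps_deriv F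
           = fps_const (a * b) * F"
proof (rule fps_ext)
  fix n
  have "c + real n \<noteq> 0"
  proof
    assume "c + real n = 0"
    then have "c = of_int (- int n)" by simp
    then show False using c by (metis nonpos_Ints_of_int of_nat_0_le_iff neg_le_0_iff_le)
  qed
  then have rec: "(c + n) * (n + 1) * fps_nth F (Suc n) = (a + n) * (b + n) * fps_nth F n"
  proof -
    have "fps_nth F (Suc n) = ((a + n) * (b + n)) / ((c + n) * (n + 1)) * fps_nth F n"
      by (simp add: F_def fps_hypergeo_rec mult_ac add_ac del: fps_hypergeo_nth)
    moreover have "(c + n) * (n + 1) \<noteq> 0"
      using \<open>c + real n \<noteq> 0\<close> by simp
    ultimately show ?thesis by simp
  qed
  have "fps_nth (fps_X * (1 - fps_X) * fps_deriv (fps_deriv F) +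
      (fps_const c - fps_const (a + b + 1) * fps_X) * fps_deriv F) n =
      (c + n) * (n + 1) * fps_nth F (Suc n) - n * (n - 1) * fps_nth F n - (a + b + 1) * n * fps_nth F n"
  proof -
    have eq: "fps_X * (1 - fps_X) * fps_deriv (fps_deriv F) +
      (fps_const c - fps_const (a + b + 1) * fps_X) * fps_deriv F =
      fps_X * fps_deriv (fps_deriv F) - fps_X * (fps_X * fps_deriv (fps_deriv F)) +
       fps_const c * fps_deriv F - fps_const (a + b + 1) * (fps_X * fps_deriv F)"
      by (simp add: algebra_simps)
    show ?thesis
      unfolding eq
      by (cases n; cases "n - 1") (auto simp: fps_X_mult_nth algebra_simps)
  qed
  also have "\<dots> = (a * b) * fps_nth F n"
    unfolding rec by (simp add: algebra_simps)
  finally show "fps_nth (fps_X * (1 - fps_X) * fps_deriv (fps_deriv F) +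
      (fps_const c - fps_const (a + b + 1) * fps_X) * fps_deriv F) n = fps_nth (fps_const (a * b) * F) n"
    by simp
qed

text \<open>
  Rotating the phase vector \<open>(G, G' / \<omega>)\<close> back by the angle \<open>\<omega> * t\<close> gives a vector with derivative
  zero.
\<close>

lemma harmonic_oscillator_unique:
  fixes G G' :: "real \<Rightarrow> real" and \<omega> :: real
  assumes \<omega>: "\<omega> \<noteq> 0" and x: "\<bar>x\<bar> < r"
    and G: "\<And>t. \<bar>t\<bar> < r \<Longrightarrow> (G has_real_derivative G' t) (at t)"
    and G': "\<And>t. \<bar>t\<bar> < r \<Longrightarrow> (G' has_real_derivative - \<omega>\<^sup>2 * G t) (at t)"
  shows "G x = G 0 * cos (\<omega> * x) + G' 0 * sin (\<omega> * x) / \<omega>"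
proof -
  define A where "A t = G t * cos (\<omega> * t) - G' t * sin (\<omega> * t) * inverse \<omega>" for t
  define B where "B t = G t * sin (\<omega> * t) + G' t * cos (\<omega> * t) * inverse \<omega>" for t
  have t: "t \<in> ball 0 r \<Longrightarrow> \<bar>t\<bar> < r" for t :: real by (simp add: dist_real_def)
  have dA: "(A has_real_derivative 0) (at t)" if "\<bar>t\<bar> < r" for t
    unfolding A_def
    by (rule derivative_eq_intros G[OF that] G'[OF that] refl)+ (use \<omega> in \<open>simp add: field_simps power2_eq_square\<close>)
  have dB: "(B has_real_derivative 0) (at t)" if "\<bar>t\<bar> < r" for t
    unfolding B_def
    by (rule derivative_eq_intros G[OF that] G'[OF that] refl)+ (use \<omega> in \<open>simp add: field_simps power2_eq_square\<close>)
  have const: "f x = f 0" if "\<And>t. \<bar>t\<bar> < r \<Longrightarrow> (f has_real_derivative 0) (at t)" for f :: "real \<Rightarrow> real"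
  proof -
    have "\<exists>c. \<forall>y\<in>ball 0 r. f y = c"
      by (intro has_field_derivative_zero_constant that[THEN has_field_derivative_at_within] t) auto
    then show ?thesis using x by (auto simp: dist_real_def)
  qed
  have A: "A x = G 0" and B: "B x = G' 0 / \<omega>"
    using const[OF dA] const[OF dB] by (auto simp: A_def B_def divide_inverse)
  have "G x = G x * ((cos (\<omega> * x))\<^sup>2 + (sin (\<omega> * x))\<^sup>2)"
    by (simp only: sin_cos_squared_add2 mult_1_right)
  also have "\<dots> = A x * cos (\<omega> * x) + B x * sin (\<omega> * x)"
    unfolding A_def B_def by algebra
  finally show ?thesis by (simp add: A B)
qed

lemma gauss_hypergeo_derivs:
  fixes a b c z :: real
  assumes "\<bar>z\<bar> < 1"
  defines "F \<equiv> fps_hypergeo [a, b] [c] 1"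
  shows "(eval_fps F has_real_derivative eval_fps (fps_deriv F) z) (at z)"
    and "(eval_fps (fps_deriv F) has_real_derivative eval_fps (fps_deriv (fps_deriv F)) z) (at z)"
    and "c \<notin> \<int>\<^sub>\<le>\<^sub>0 \<Longrightarrow> z * (1 - z) * eval_fps (fps_deriv (fps_deriv F)) z + (c - (a + b + 1) * z) * eval_fps (fps_deriv F) z
       = a * b * eval_fps F z"
proof -
  have r0: "fps_conv_radius F \<ge> 1" unfolding F_def by (rule fps_conv_radius_hypergeo_2_1)
  have r1: "fps_conv_radius (fps_deriv F) \<ge> 1" using r0 fps_conv_radius_deriv order.trans by blast
  have r2: "fps_conv_radius (fps_deriv (fps_deriv F)) \<ge> 1" using r1 fps_conv_radius_deriv order.trans by blast
  have z: "ereal (norm z) < R" if "R \<ge> 1" for R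
  proof -
    have "ereal (norm z) < 1" using assms(1) by simp
    then show ?thesis using that by (rule less_le_trans)
  qed
  show "(eval_fps F has_real_derivative eval_fps (fps_deriv F) z) (at z)"
    by (intro has_field_derivative_eval_fps z r0)
  show "(eval_fps (fps_deriv F) has_real_derivative eval_fps (fps_deriv (fps_deriv F)) z) (at z)"
    by (intro has_field_derivative_eval_fps z r1)
  have m: "fps_conv_radius (f * g) \<ge> 1" if "fps_conv_radius f \<ge> 1" "fps_conv_radius g \<ge> 1" for f g :: "real fps"
    using fps_conv_radius_mult[of f g] that by (meson min.boundedI order.trans)
  have d: "fps_conv_radius (f - g) \<ge> 1" if "fps_conv_radius f \<ge> 1" "fps_conv_radius g \<ge> 1" for f g :: "real fps"
    using fps_conv_radius_diff[of f g] that by (meson min.boundedI order.trans)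
  have evm: "eval_fps (f * g) z = eval_fps f z * eval_fps g z"
    if "fps_conv_radius f \<ge> 1" "fps_conv_radius g \<ge> 1" for f g :: "real fps"
    by (intro eval_fps_mult z that)
  have eva: "eval_fps (f + g) z = eval_fps f z + eval_fps g z"
    if "fps_conv_radius f \<ge> 1" "fps_conv_radius g \<ge> 1" for f g :: "real fps"
    by (intro eval_fps_add z that)
  have evd: "eval_fps (f - g) z = eval_fps f z - eval_fps g z"
    if "fps_conv_radius f \<ge> 1" "fps_conv_radius g \<ge> 1" for f g :: "real fps"
    by (intro eval_fps_diff z that)
  assume c: "c \<notin> \<int>\<^sub>\<le>\<^sub>0"
  from arg_cong[OF fps_hypergeo_2_1_ode[OF c, of a b, folded F_def], of "\<lambda>f. eval_fps f z"]
  show "z * (1 - z) * eval_fps (fps_deriv (fps_deriv F)) z + (c - (a + b + 1) * z) * eval_fps (fps_deriv F) z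
       = a * b * eval_fps F z"
    by (simp add: evm eva evd m d r0 r1 r2 del: fps_const_add fps_const_mult)
qed

text \<open>
  The substitution \<open>z = (sin t)\<^sup>2\<close> in the hypergeometric equation. The parameters \<open>a\<close> and \<open>1 - a\<close> are
  those of the eigenvalues of the Minkowski--Funk transform.
\<close>

lemma hypergeo_of_sin_squared:
  fixes a c t :: real
  assumes c: "c \<notin> \<int>\<^sub>\<le>\<^sub>0" and t: "\<bar>t\<bar> < pi / 2"
  defines "F \<equiv> fps_hypergeo [a, 1 - a] [c] 1"
  shows "((\<lambda>t. eval_fps F ((sin t)\<^sup>2)) has_real_derivative
            eval_fps (fps_deriv F) ((sin t)\<^sup>2) * (2 * sin t * cos t)) (at t)"
    and "((\<lambda>t. eval_fps (fps_deriv F) ((sin t)\<^sup>2)) has_real_derivative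
            eval_fps (fps_deriv (fps_deriv F)) ((sin t)\<^sup>2) * (2 * sin t * cos t)) (at t)"
    and "(sin t)\<^sup>2 * (cos t)\<^sup>2 * eval_fps (fps_deriv (fps_deriv F)) ((sin t)\<^sup>2)
           + (c - 2 * (sin t)\<^sup>2) * eval_fps (fps_deriv F) ((sin t)\<^sup>2)
         = a * (1 - a) * eval_fps F ((sin t)\<^sup>2)"
proof -
  have "cos t > 0" using t by (intro cos_gt_zero_pi) auto
  then have "(sin t)\<^sup>2 < 1" by (simp add: sin_squared_eq)
  then have "\<bar>(sin t)\<^sup>2\<bar> < 1" by simp
  note * = gauss_hypergeo_derivs[OF this, where a=a and b="1-a" and c=c, folded F_def]
  have chain: "((\<lambda>t. f ((sin t)\<^sup>2)) has_real_derivative d * (2 * sin t * cos t)) (at t)"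
    if "(f has_real_derivative d) (at ((sin t)\<^sup>2))" for f d
    by (rule DERIV_chain2[where g = "\<lambda>t. (sin t)\<^sup>2", OF that]) (auto intro!: derivative_eq_intros)
  show "((\<lambda>t. eval_fps F ((sin t)\<^sup>2)) has_real_derivative
            eval_fps (fps_deriv F) ((sin t)\<^sup>2) * (2 * sin t * cos t)) (at t)"
    by (rule chain[OF *(1)])
  show "((\<lambda>t. eval_fps (fps_deriv F) ((sin t)\<^sup>2)) has_real_derivative
            eval_fps (fps_deriv (fps_deriv F)) ((sin t)\<^sup>2) * (2 * sin t * cos t)) (at t)"
    by (rule chain[OF *(2)])
  show "(sin t)\<^sup>2 * (cos t)\<^sup>2 * eval_fps (fps_deriv (fps_deriv F)) ((sin t)\<^sup>2)
           + (c - 2 * (sin t)\<^sup>2) * eval_fps (fps_deriv F) ((sin t)\<^sup>2)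
         = a * (1 - a) * eval_fps F ((sin t)\<^sup>2)"
    using *(3)[OF c] by (simp add: cos_squared_eq)
qed

text \<open>
  Multiplying by \<open>cos t\<close> removes the first-order term from the equation in the variable \<open>t\<close>: the
  product satisfies the equation of a harmonic oscillator with frequency \<open>2 * a - 1\<close>.
\<close>

lemma hypergeo_one_half:
  fixes a x :: real
  assumes a: "2 * a \<noteq> 1" and x: "\<bar>x\<bar> < pi / 2"
  shows "eval_fps (fps_hypergeo [a, 1 - a] [1 / 2] 1) ((sin x)\<^sup>2) * cos x = cos ((2 * a - 1) * x)"
proof -
  have c: "1 / 2 \<notin> (\<int>\<^sub>\<le>\<^sub>0 :: real set)"
    using nonpos_Ints_nonpos by fastforce
  define \<omega> where "\<omega> = 2 * a - 1"
  have \<omega>: "\<omega> \<noteq> 0" using a by (simp add: \<omega>_def)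
  define F where "F = fps_hypergeo [a, 1 - a] [1 / 2 :: real] 1"
  define f where "f t = eval_fps F ((sin t)\<^sup>2)" for t
  define f1 where "f1 t = eval_fps (fps_deriv F) ((sin t)\<^sup>2)" for t
  define f2 where "f2 t = eval_fps (fps_deriv (fps_deriv F)) ((sin t)\<^sup>2)" for t
  note derivs = hypergeo_of_sin_squared[OF c, of _ a, folded F_def, folded f_def f1_def f2_def]
  define G where "G t = f t * cos t" for t
  define G' where "G' t = f1 t * (2 * sin t * cos t) * cos t - f t * sin t" for t
  have dG: "(G has_real_derivative G' t) (at t)" if t: "\<bar>t\<bar> < pi / 2" for t
    unfolding G_def G'_def
    by (rule derivative_eq_intros derivs(1)[OF t] refl)+ (simp add: algebra_simps)
  have dG': "(G' has_real_derivative - \<omega>\<^sup>2 * G t) (at t)" if t: "\<bar>t\<bar> < pi / 2" for t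
  proof -
    define s where "s = sin t"
    define k where "k = cos t"
    have sk: "s\<^sup>2 = 1 - k\<^sup>2" by (simp add: s_def k_def sin_squared_eq)
    have ode: "s\<^sup>2 * k\<^sup>2 * f2 t + (1 / 2 - 2 * s\<^sup>2) * f1 t = a * (1 - a) * f t"
      using derivs(3)[OF t] by (simp add: s_def k_def)
    have "(f2 t * (2 * s * k) * (2 * s * k) + f1 t * (2 * k * k - 2 * s * s)) * k - f1 t * (2 * s * k) * s
            - (f1 t * (2 * s * k) * s + f t * k) = - \<omega>\<^sup>2 * (f t * k)"
      using ode sk unfolding \<omega>_def by algebra
    then show ?thesis
      unfolding G_def G'_def s_def k_def
      by - (rule derivative_eq_intros derivs(1)[OF t] derivs(2)[OF t] refl | simp add: algebra_simps)+
  qed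
  have "G x = G 0 * cos (\<omega> * x) + G' 0 * sin (\<omega> * x) / \<omega>"
    by (rule harmonic_oscillator_unique[OF \<omega> x dG dG'])
  also have "G 0 = 1" by (simp add: G_def f_def F_def eval_fps_at_0)
  also have "G' 0 = 0" by (simp add: G'_def f_def F_def eval_fps_at_0)
  finally show ?thesis
    by (simp add: G_def f_def F_def \<omega>_def)
qed

text \<open>
  For the third parameter \<open>3 / 2\<close> it is the factor \<open>sin t\<close> that leads to the same oscillator.
\<close>

lemma hypergeo_three_halves:
  fixes a x :: real
  assumes a: "2 * a \<noteq> 1" and x: "\<bar>x\<bar> < pi / 2"
  shows "eval_fps (fps_hypergeo [a, 1 - a] [3 / 2] 1) ((sin x)\<^sup>2) * sin x = sin ((2 * a - 1) * x) / (2 * a - 1)"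
proof -
  have c: "3 / 2 \<notin> (\<int>\<^sub>\<le>\<^sub>0 :: real set)"
    using nonpos_Ints_nonpos by fastforce
  define \<omega> where "\<omega> = 2 * a - 1"
  have \<omega>: "\<omega> \<noteq> 0" using a by (simp add: \<omega>_def)
  define F where "F = fps_hypergeo [a, 1 - a] [3 / 2 :: real] 1"
  define f where "f t = eval_fps F ((sin t)\<^sup>2)" for t
  define f1 where "f1 t = eval_fps (fps_deriv F) ((sin t)\<^sup>2)" for t
  define f2 where "f2 t = eval_fps (fps_deriv (fps_deriv F)) ((sin t)\<^sup>2)" for t
  note derivs = hypergeo_of_sin_squared[OF c, of _ a, folded F_def, folded f_def f1_def f2_def]
  define G where "G t = f t * sin t" for t
  define G' where "G' t = f1 t * (2 * sin t * cos t) * sin t + f t * cos t" for t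
  have dG: "(G has_real_derivative G' t) (at t)" if t: "\<bar>t\<bar> < pi / 2" for t
    unfolding G_def G'_def
    by (rule derivative_eq_intros derivs(1)[OF t] refl)+ (simp add: algebra_simps)
  have dG': "(G' has_real_derivative - \<omega>\<^sup>2 * G t) (at t)" if t: "\<bar>t\<bar> < pi / 2" for t
  proof -
    define s where "s = sin t"
    define k where "k = cos t"
    have sk: "s\<^sup>2 = 1 - k\<^sup>2" by (simp add: s_def k_def sin_squared_eq)
    have ode: "s\<^sup>2 * k\<^sup>2 * f2 t + (3 / 2 - 2 * s\<^sup>2) * f1 t = a * (1 - a) * f t"
      using derivs(3)[OF t] by (simp add: s_def k_def)
    have "(f2 t * (2 * s * k) * (2 * s * k) + f1 t * (2 * k * k - 2 * s * s)) * s + f1 t * (2 * s * k) * k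
            + (f1 t * (2 * s * k) * k - f t * s) = - \<omega>\<^sup>2 * (f t * s)"
      using ode sk unfolding \<omega>_def by algebra
    then show ?thesis
      unfolding G_def G'_def s_def k_def
      by - (rule derivative_eq_intros derivs(1)[OF t] derivs(2)[OF t] refl | simp add: algebra_simps)+
  qed
  have "G x = G 0 * cos (\<omega> * x) + G' 0 * sin (\<omega> * x) / \<omega>"
    by (rule harmonic_oscillator_unique[OF \<omega> x dG dG'])
  also have "G 0 = 0" by (simp add: G_def f_def F_def eval_fps_at_0)
  also have "G' 0 = 1" by (simp add: G'_def f_def F_def eval_fps_at_0)
  finally show ?thesis
    by (simp add: G_def f_def F_def \<omega>_def)
qed

section \<open>Harmonic polynomials in the unit ball\<close>

lemma polynomial_function_frechet_derivative:
  fixes f :: "'a::euclidean_space \<Rightarrow> 'b::euclidean_space"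
  assumes "polynomial_function f"
  shows "polynomial_function (\<lambda>x. frechet_derivative f (at x) v)"
proof -
  have real: "real_polynomial_function (\<lambda>x. frechet_derivative p (at x) v)"
    if "real_polynomial_function p" for p :: "'a \<Rightarrow> real"
    using that
  proof induction
    case (linear f)
    then have "frechet_derivative f (at x) = f" for x
      by (intro frechet_derivative_at[symmetric] bounded_linear_imp_has_derivative)
    then show ?case by (simp add: real_polynomial_function.intros(2))
  next
    case (add f g)
    then have "frechet_derivative (\<lambda>x. f x + g x) (at x) v = frechet_derivative f (at x) v + frechet_derivative g (at x) v" for x
      by (subst frechet_derivative_at[symmetric, OF has_derivative_add])
        (auto simp: frechet_derivative_works[symmetric] differentiable_at_real_polynomial_function)
    then show ?case using add.IH by auto
  next
    case (mult f g)
    then have "frechet_derivative (\<lambda>x. f x * g x) (at x) v = f x * frechet_derivative g (at x) v + frechet_derivative f (at x) v * g x" for x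
      by (subst frechet_derivative_at[symmetric, OF has_derivative_mult])
        (auto simp: frechet_derivative_works[symmetric] differentiable_at_real_polynomial_function)
    then show ?case using mult by auto
  qed auto
  have "(frechet_derivative f (at x) v) \<bullet> b = frechet_derivative (\<lambda>x. f x \<bullet> b) (at x) v" for x b
  proof -
    have "(f has_derivative frechet_derivative f (at x)) (at x)"
      by (simp add: frechet_derivative_works[symmetric] differentiable_at_polynomial_function assms)
    then have "((\<lambda>x. f x \<bullet> b) has_derivative (\<lambda>v. frechet_derivative f (at x) v \<bullet> b)) (at x)"
      by (rule has_derivative_inner_left)
    from frechet_derivative_at[OF this] show ?thesis by metis
  qed
  then show ?thesis
    using assms real by (simp add: polynomial_function_iff_Basis_inner)
qed

lemma integrable_continuous_compact_support:
  fixes f :: "'a::euclidean_space \<Rightarrow> 'b::euclidean_space"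
  assumes "continuous_on UNIV f" and "\<And>x. R < norm x \<Longrightarrow> f x = 0"
  shows "integrable lborel f"
proof -
  have "integrable lborel (\<lambda>x. indicator (cball 0 R) x *\<^sub>R f x)"
    by (rule borel_integrable_compact) (auto intro: continuous_on_subset[OF assms(1)])
  moreover have "(\<lambda>x. indicator (cball 0 R) x *\<^sub>R f x) = f"
    using assms(2) by (auto simp: indicator_def fun_eq_iff not_le)
  ultimately show ?thesis by simp
qed

lemma lborel_integral_translation:
  fixes f :: "'a::euclidean_space \<Rightarrow> 'b::euclidean_space"
  assumes "f \<in> borel_measurable borel"
  shows "(LINT x|lborel. f (c + x)) = (LINT x|lborel. f x)"
proof -
  have "(LINT x|lborel. f x) = (LINT x|distr lborel borel ((+) c). f x)"
    by (simp add: lborel_distr_plus)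
  also have "\<dots> = (LINT x|lborel. f (c + x))"
    using assms by (subst integral_distr) auto
  finally show ?thesis by simp
qed

text \<open>
  The integral of \<open>H\<close> does not change under translation in the direction \<open>e\<close>. So all difference
  quotients of \<open>H\<close> in this direction have integral zero, and they converge to the derivative
  boundedly and on a bounded set.
\<close>

lemma integral_directional_derivative_compact_support:
  fixes H :: "'a::euclidean_space \<Rightarrow> 'b::euclidean_space" and e :: 'a
  assumes der: "\<And>x. (H has_derivative H' x) (at x)"
    and cont: "continuous_on UNIV (\<lambda>x. H' x e)"
    and supp: "\<And>x. R < norm x \<Longrightarrow> H x = 0"
  shows "(LINT x|lborel. H' x e) = 0"
proof -
  have contH: "continuous_on UNIV H"
    by (intro continuous_at_imp_continuous_on ballI has_derivative_continuous[OF der])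
  then have Hmeas: "H \<in> borel_measurable borel" by (rule borel_measurable_continuous_onI)
  define q where "q i x = real (Suc i) *\<^sub>R (H (x + (1 / real (Suc i)) *\<^sub>R e) - H x)" for i x
  have line: "((\<lambda>s. H (x + s *\<^sub>R e)) has_derivative (\<lambda>h. h *\<^sub>R H' (x + s *\<^sub>R e) e)) (at s within S)" for x s S
  proof -
    have "((\<lambda>s. H (x + s *\<^sub>R e)) has_derivative (\<lambda>h. H' (x + s *\<^sub>R e) (h *\<^sub>R e))) (at s within S)"
      by (rule has_derivative_compose[OF _ der, where f = "\<lambda>s. x + s *\<^sub>R e"])
        (auto intro!: derivative_eq_intros)
    then show ?thesis
      using has_derivative_bounded_linear[OF der] by (simp add: linear_scale bounded_linear.linear)
  qed
  obtain M where M: "\<And>x. norm x \<le> R + 2 * norm e \<Longrightarrow> norm (H' x e) \<le> M" "M \<ge> 0"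
  proof -
    have "bounded ((\<lambda>x. H' x e) ` cball 0 (R + 2 * norm e))"
      by (intro compact_imp_bounded compact_continuous_image continuous_on_subset[OF cont]) auto
    then obtain M where "\<forall>y\<in>(\<lambda>x. H' x e) ` cball 0 (R + 2 * norm e). norm y \<le> M"
      by (auto simp: bounded_iff)
    then have "norm (H' x e) \<le> max M 0" if "norm x \<le> R + 2 * norm e" for x
      using that by (simp add: le_max_iff_disj)
    then show ?thesis using that by (meson max.cobounded2)
  qed
  have lim: "(\<lambda>i. LINT x|lborel. q i x) \<longlonglongrightarrow> (LINT x|lborel. H' x e)"
  proof (rule integral_dominated_convergence)
    show "(\<lambda>x. H' x e) \<in> borel_measurable lborel"
      using borel_measurable_continuous_onI[OF cont] by simp
    show "q i \<in> borel_measurable lborel" for i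
      unfolding q_def using Hmeas by measurable
    show "integrable lborel (\<lambda>x. M * indicator (cball 0 (R + norm e)) x)"
      by (intro integrable_mult_right integrable_real_indicator) (auto simp: emeasure_lborel_cball_finite[unfolded infinity_ennreal_def])
    show "AE x in lborel. (\<lambda>i. q i x) \<longlonglongrightarrow> H' x e"
    proof (intro AE_I2)
      fix x
      have "((\<lambda>s. norm (H (x + s *\<^sub>R e) - H x - s *\<^sub>R H' x e) / norm s) \<longlongrightarrow> 0) (at 0)"
        using line[of x 0 UNIV] by (simp add: has_derivative_at)
      moreover have "\<forall>\<^sub>F s in at 0. norm (H (x + s *\<^sub>R e) - H x - s *\<^sub>R H' x e) / norm s
          = norm ((H (x + s *\<^sub>R e) - H x) /\<^sub>R s - H' x e)"
      proof (rule eventually_at_topological[THEN iffD2], intro exI[of _ UNIV] conjI ballI impI)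
        fix s :: real assume "s \<noteq> 0"
        then have "(H (x + s *\<^sub>R e) - H x) /\<^sub>R s - H' x e = (H (x + s *\<^sub>R e) - H x - s *\<^sub>R H' x e) /\<^sub>R s"
          by (simp add: scaleR_diff_right)
        then show "norm (H (x + s *\<^sub>R e) - H x - s *\<^sub>R H' x e) / norm s
          = norm ((H (x + s *\<^sub>R e) - H x) /\<^sub>R s - H' x e)"
          by (simp add: divide_inverse mult.commute)
      qed auto
      ultimately have "((\<lambda>s. norm ((H (x + s *\<^sub>R e) - H x) /\<^sub>R s - H' x e)) \<longlongrightarrow> 0) (at 0)"
        by (rule Lim_transform_eventually)
      then have "((\<lambda>s. (H (x + s *\<^sub>R e) - H x) /\<^sub>R s) \<longlongrightarrow> H' x e) (at 0)"
        by (rule LIM_zero_cancel[OF tendsto_norm_zero_cancel])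
      moreover have "filterlim (\<lambda>i. 1 / real (Suc i)) (at 0) sequentially"
        using LIMSEQ_inverse_real_of_nat by (simp add: filterlim_at inverse_eq_divide)
      ultimately have "((\<lambda>i. (H (x + (1 / real (Suc i)) *\<^sub>R e) - H x) /\<^sub>R (1 / real (Suc i))) \<longlongrightarrow> H' x e) sequentially"
        by (rule filterlim_compose)
      then show "(\<lambda>i. q i x) \<longlonglongrightarrow> H' x e" by (simp add: q_def)
    qed
    show "AE x in lborel. norm (q i x) \<le> M * indicator (cball 0 (R + norm e)) x" for i
    proof (intro AE_I2)
      fix x
      define t where "t = 1 / real (Suc i)"
      have t: "0 < t" "t \<le> 1" by (auto simp: t_def)
      have ts: "norm (s *\<^sub>R e) \<le> norm e" if "0 \<le> s" "s \<le> t" for s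
        using that t by (simp add: mult_left_le_one_le)
      show "norm (q i x) \<le> M * indicator (cball 0 (R + norm e)) x"
      proof (cases "norm x \<le> R + norm e")
        case True
        have "norm (H (x + t *\<^sub>R e) - H (x + 0 *\<^sub>R e)) \<le> M * norm (t - 0)"
        proof (rule differentiable_bound[of "{0..t}" "\<lambda>s. H (x + s *\<^sub>R e)"])
          show "((\<lambda>s. H (x + s *\<^sub>R e)) has_derivative (\<lambda>h. h *\<^sub>R H' (x + s *\<^sub>R e) e)) (at s within {0..t})" for s
            by (rule line)
          fix s assume "s \<in> {0..t}"
          then have "norm (x + s *\<^sub>R e) \<le> R + 2 * norm e"
            using ts[of s] True norm_triangle_ineq[of x "s *\<^sub>R e"] by auto
          then have "norm (H' (x + s *\<^sub>R e) e) \<le> M" by (rule M)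
          then show "onorm (\<lambda>h. h *\<^sub>R H' (x + s *\<^sub>R e) e) \<le> M"
            by (intro onorm_le) (simp add: mult.commute[of M] mult_left_mono)
        qed (use t in auto)
        then have "norm (H (x + t *\<^sub>R e) - H x) \<le> M * t" using t by simp
        then have "norm ((1 / t) *\<^sub>R (H (x + t *\<^sub>R e) - H x)) \<le> M"
          using t by (simp only: norm_scaleR) (simp add: field_simps)
        then show ?thesis using True by (simp add: q_def t_def)
      next
        case False
        have "norm x \<le> norm (x + t *\<^sub>R e) + norm (t *\<^sub>R e)"
          by (metis add_diff_cancel_right' norm_triangle_ineq4)
        then have "norm (x + t *\<^sub>R e) > R" "norm x > R"
          using False ts[of t] t norm_ge_zero[of e] by linarith+
        then show ?thesis using False by (simp add: q_def t_def supp)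
      qed
    qed
  qed
  have "(LINT x|lborel. q i x) = 0" for i
  proof -
    define t where "t = 1 / real (Suc i)"
    have int: "integrable lborel H"
      by (rule integrable_continuous_compact_support[OF contH supp])
    have int': "integrable lborel (\<lambda>x. H (x + t *\<^sub>R e))"
    proof (rule integrable_continuous_compact_support[where R = "R + norm (t *\<^sub>R e)"])
      show "continuous_on UNIV (\<lambda>x. H (x + t *\<^sub>R e))"
        by (rule continuous_on_compose2[OF contH]) (auto intro!: continuous_intros)
      fix x :: 'a assume "R + norm (t *\<^sub>R e) < norm x"
      moreover have "norm x \<le> norm (x + t *\<^sub>R e) + norm (t *\<^sub>R e)"
        by (metis add_diff_cancel_right' norm_triangle_ineq4)
      ultimately show "H (x + t *\<^sub>R e) = 0" by (intro supp) linarith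
    qed
    have "(LINT x|lborel. q i x) = real (Suc i) *\<^sub>R ((LINT x|lborel. H (x + t *\<^sub>R e)) - (LINT x|lborel. H x))"
      unfolding q_def t_def[symmetric] using int int' by simp
    also have "(LINT x|lborel. H (x + t *\<^sub>R e)) = (LINT x|lborel. H x)"
      using lborel_integral_translation[OF Hmeas, of "t *\<^sub>R e"] by (simp add: add.commute)
    finally show ?thesis by simp
  qed
  with lim show ?thesis by (simp add: LIMSEQ_const_iff)
qed

lemma has_derivative_polynomial_function:
  fixes f :: "'a::euclidean_space \<Rightarrow> 'b::euclidean_space"
  assumes "polynomial_function f"
  shows "(f has_derivative frechet_derivative f (at x)) (at x)"
  using differentiable_at_polynomial_function[OF assms] by (simp add: frechet_derivative_works)

lemma Euler_homogeneous:
  fixes f :: "'a::euclidean_space \<Rightarrow> complex"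
  assumes "polynomial_function f" and hom: "\<And>c x. f (c *\<^sub>R x) = c ^ j *\<^sub>R f x"
  shows "frechet_derivative f (at x) x = of_nat j * f x"
proof -
  have "((\<lambda>c. f (c *\<^sub>R x)) has_derivative (\<lambda>h. frechet_derivative f (at (1 *\<^sub>R x)) (h *\<^sub>R x))) (at 1)"
    by (rule has_derivative_compose[OF _ has_derivative_polynomial_function[OF assms(1)], where f = "\<lambda>c. c *\<^sub>R x"])
      (auto intro!: derivative_eq_intros)
  moreover have "((\<lambda>c. f (c *\<^sub>R x)) has_derivative (\<lambda>h. (h * real j) *\<^sub>R f x)) (at 1)"
    unfolding hom by (auto intro!: derivative_eq_intros simp: mult.commute)
  ultimately have "(\<lambda>h. frechet_derivative f (at (1 *\<^sub>R x)) (h *\<^sub>R x)) = (\<lambda>h. (h * real j) *\<^sub>R f x)"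
    by (rule has_derivative_unique)
  from fun_cong[OF this, of 1] show ?thesis by (simp add: scaleR_conv_of_real)
qed

text \<open>
  The divergence theorem for the vector field \<open>g * w(\<bar>x\<bar>\<^sup>2) * grad f\<close>, which vanishes outside the
  unit ball. As \<open>f\<close> is harmonic, its divergence is \<open>w * (grad g \<bullet> grad f)\<close> plus the term from the
  weight, \<open>2 * v(\<bar>x\<bar>\<^sup>2) * g * (x \<bullet> grad f)\<close>, in which Euler's identity replaces \<open>x \<bullet> grad f\<close> by \<open>j * f\<close>.
  Since \<open>\<bar>x\<bar>\<^sup>2 \<ge> 0\<close>, the behaviour of \<open>w\<close> on the negative axis matters only near \<open>0\<close>.
\<close>

lemma Green_identity_radial_weight:
  fixes f g :: "'a::euclidean_space \<Rightarrow> complex" and w v :: "real \<Rightarrow> real"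
  assumes f: "polynomial_function f" and g: "polynomial_function g"
    and hom: "\<And>c x. f (c *\<^sub>R x) = c ^ j *\<^sub>R f x"
    and harm: "\<And>x. (\<Sum>b\<in>Basis. frechet_derivative (\<lambda>y. frechet_derivative f (at y) b) (at x) b) = 0"
    and w: "\<And>t. -1 < t \<Longrightarrow> (w has_real_derivative v t) (at t)"
    and v: "continuous_on UNIV v"
    and supp: "\<And>t. 1 \<le> t \<Longrightarrow> w t = 0" "\<And>t. 1 \<le> t \<Longrightarrow> v t = 0"
  shows "(LINT x|lborel. (\<Sum>b\<in>Basis. frechet_derivative g (at x) b * frechet_derivative f (at x) b) * of_real (w (x \<bullet> x)))
    = - 2 * of_nat j * (LINT x|lborel. f x * g x * of_real (v (x \<bullet> x)))"
proof -
  let ?Df = "\<lambda>b x. frechet_derivative f (at x) b"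
  let ?Dg = "\<lambda>b x. frechet_derivative g (at x) b"
  let ?D2f = "\<lambda>b x. frechet_derivative (?Df b) (at x) b"
  let ?W = "\<lambda>x::'a. complex_of_real (w (x \<bullet> x))"
  let ?V = "\<lambda>x::'a. complex_of_real (v (x \<bullet> x))"
  note poly = polynomial_function_frechet_derivative
  have pDf: "polynomial_function (?Df b)" for b by (rule poly[OF f])
  have cont: "continuous_on UNIV f" "continuous_on UNIV g" "continuous_on UNIV (?Df b)" "continuous_on UNIV (?Dg b)"
    "continuous_on UNIV (?D2f b)" for b
    by (intro continuous_on_polymonial_function f g pDf poly)+
  have dW: "(?W has_derivative (\<lambda>h. of_real (v (x \<bullet> x) * (2 * (x \<bullet> h))))) (at x)" for x
  proof -
    have "-1 < x \<bullet> x" using inner_ge_zero[of x] by linarith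
    then have "((\<lambda>x. w (x \<bullet> x)) has_derivative (\<lambda>h. v (x \<bullet> x) * (2 * (x \<bullet> h)))) (at x)"
      by (intro has_derivative_compose[OF _ w[unfolded has_field_derivative_def], where f = "\<lambda>x. x \<bullet> x"])
        (auto intro!: derivative_eq_intros simp: inner_commute)
    then show ?thesis by (rule has_derivative_of_real)
  qed
  have contW: "continuous_on UNIV ?W"
    by (intro continuous_at_imp_continuous_on ballI has_derivative_continuous[OF dW])
  have contV: "continuous_on UNIV ?V"
    by (intro continuous_intros continuous_on_compose2[OF v]) auto
  have norm1: "1 \<le> x \<bullet> x" if "1 < norm x" for x :: 'a
    using that one_le_power[of "norm x" 2] by (simp add: dot_square_norm)
  have suppW: "?W x = 0" "?V x = 0" if "1 < norm x" for x
    using supp norm1[OF that] by auto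
  have int: "integrable lborel (\<lambda>x. h x * ?W x)" "integrable lborel (\<lambda>x. h x * ?V x)"
    if "continuous_on UNIV h" for h
    by (rule integrable_continuous_compact_support[where R = 1];
        use that contW contV suppW in \<open>auto intro!: continuous_intros\<close>)+
  define E where "E b x = ?Dg b x * ?Df b x * ?W x + g x * ?D2f b x * ?W x
      + 2 * (complex_of_real (x \<bullet> b) * ?Df b x * g x * ?V x)" for b x
  have "(LINT x|lborel. E b x) = 0" for b
  proof -
    define H' where "H' x h = (g x * ?Df b x) * of_real (v (x \<bullet> x) * (2 * (x \<bullet> h)))
        + (g x * frechet_derivative (?Df b) (at x) h + frechet_derivative g (at x) h * ?Df b x) * ?W x" for x h
    have eq: "H' x b = E b x" for x by (simp add: H'_def E_def algebra_simps)
    have "(LINT x|lborel. H' x b) = 0"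
    proof (rule integral_directional_derivative_compact_support[where R = 1])
      show "((\<lambda>x. (g x * ?Df b x) * ?W x) has_derivative H' x) (at x)" for x
        unfolding H'_def
        by (intro has_derivative_mult has_derivative_polynomial_function f g pDf dW)
      show "continuous_on UNIV (\<lambda>x. H' x b)"
        unfolding eq E_def by (intro continuous_intros cont contW contV)
    qed (use suppW in auto)
    then show ?thesis by (simp add: eq)
  qed
  moreover have "integrable lborel (E b)" for b
  proof -
    show ?thesis
      unfolding E_def by (intro Bochner_Integration.integrable_add integrable_mult_right int continuous_intros cont)
  qed
  ultimately have "(LINT x|lborel. (\<Sum>b\<in>Basis. E b x)) = 0"
    by (subst Bochner_Integration.integral_sum) auto
  moreover have "(\<Sum>b\<in>Basis. E b x) = (\<Sum>b\<in>Basis. ?Dg b x * ?Df b x) * ?W x + 2 * of_nat j * (f x * g x * ?V x)" for x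
  proof -
    have "(\<Sum>b\<in>Basis. complex_of_real (x \<bullet> b) * ?Df b x) = frechet_derivative f (at x) x"
    proof -
      have lin: "linear (frechet_derivative f (at x))"
        using has_derivative_bounded_linear[OF has_derivative_polynomial_function[OF f]] by (rule bounded_linear.linear)
      have "frechet_derivative f (at x) x = frechet_derivative f (at x) (\<Sum>b\<in>Basis. (x \<bullet> b) *\<^sub>R b)"
        by (simp add: euclidean_representation)
      also have "\<dots> = (\<Sum>b\<in>Basis. (x \<bullet> b) *\<^sub>R ?Df b x)"
        by (simp add: linear_sum[OF lin] linear_scale[OF lin])
      finally show ?thesis by (simp add: scaleR_conv_of_real)
    qed
    then have eul: "(\<Sum>b\<in>Basis. complex_of_real (x \<bullet> b) * ?Df b x) = of_nat j * f x"
      using Euler_homogeneous[OF f hom] by simp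
    have "(\<Sum>b\<in>Basis. E b x) = (\<Sum>b\<in>Basis. ?Dg b x * ?Df b x) * ?W x + g x * ?W x * (\<Sum>b\<in>Basis. ?D2f b x)
        + 2 * ((\<Sum>b\<in>Basis. complex_of_real (x \<bullet> b) * ?Df b x) * g x * ?V x)"
      unfolding E_def sum.distrib sum_distrib_left sum_distrib_right by (simp add: mult_ac)
    then show ?thesis unfolding harm eul by (simp add: mult_ac)
  qed
  moreover have "(LINT x|lborel. (\<Sum>b\<in>Basis. ?Dg b x * ?Df b x) * ?W x + 2 * of_nat j * (f x * g x * ?V x))
      = (LINT x|lborel. (\<Sum>b\<in>Basis. ?Dg b x * ?Df b x) * ?W x) + 2 * of_nat j * (LINT x|lborel. f x * g x * ?V x)"
    by (subst Bochner_Integration.integral_add) (auto intro!: int continuous_intros cont)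
  ultimately show ?thesis by (simp add: add_eq_0_iff2)
qed

text \<open>
  The left-hand side of the preceding identity is symmetric in \<open>f\<close> and \<open>g\<close>, the right-hand side is
  the integral multiplied by the degree of one of them. Any weight \<open>v\<close> occurs, with \<open>w\<close> the
  antiderivative that vanishes at \<open>1\<close>.
\<close>

lemma harmonic_orthogonal_radial_weight:
  fixes f g :: "'a::euclidean_space \<Rightarrow> complex" and v :: "real \<Rightarrow> real"
  assumes f: "polynomial_function f" and g: "polynomial_function g"
    and homf: "\<And>c x. f (c *\<^sub>R x) = c ^ j *\<^sub>R f x" and homg: "\<And>c x. g (c *\<^sub>R x) = c ^ k *\<^sub>R g x"
    and harmf: "\<And>x. (\<Sum>b\<in>Basis. frechet_derivative (\<lambda>y. frechet_derivative f (at y) b) (at x) b) = 0"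
    and harmg: "\<And>x. (\<Sum>b\<in>Basis. frechet_derivative (\<lambda>y. frechet_derivative g (at y) b) (at x) b) = 0"
    and "j \<noteq> k"
    and v: "continuous_on UNIV v" and supp: "\<And>t. 1 \<le> t \<Longrightarrow> v t = 0"
  shows "(LINT x|lborel. f x * g x * of_real (v (x \<bullet> x))) = 0"
proof -
  define w where "w t = integral {-1..t} v - integral {-1..1} v" for t
  have vint: "v integrable_on {a..b}" for a b
    by (intro integrable_continuous_real continuous_on_subset[OF v]) auto
  have w: "(w has_real_derivative v t) (at t)" if "-1 < t" for t
  proof -
    have "((\<lambda>x. integral {-1..x} v) has_real_derivative v t) (at t within {-1..t+1})"
      using that by (intro integral_has_real_derivative continuous_on_subset[OF v]) auto
    then have "((\<lambda>x. integral {-1..x} v) has_real_derivative v t) (at t)"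
      using that by (simp add: at_within_Icc_at)
    then show ?thesis unfolding w_def by (auto intro!: derivative_eq_intros)
  qed
  have w0: "w t = 0" if "1 \<le> t" for t
  proof -
    have "integral {-1..1} v + integral {1..t} v = integral {-1..t} v"
      using that vint by (intro Henstock_Kurzweil_Integration.integral_combine) auto
    moreover have "integral {1..t} v = integral {1..t} (\<lambda>_. 0)"
      by (rule integral_cong) (use supp in auto)
    ultimately show ?thesis by (simp add: w_def)
  qed
  have "- 2 * of_nat j * (LINT x|lborel. f x * g x * of_real (v (x \<bullet> x)))
      = (LINT x|lborel. (\<Sum>b\<in>Basis. frechet_derivative g (at x) b * frechet_derivative f (at x) b) * of_real (w (x \<bullet> x)))"
    by (rule Green_identity_radial_weight[OF f g homf harmf w v w0 supp, symmetric])
  also have "\<dots> = (LINT x|lborel. (\<Sum>b\<in>Basis. frechet_derivative f (at x) b * frechet_derivative g (at x) b) * of_real (w (x \<bullet> x)))"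
    by (simp add: mult.commute)
  also have "\<dots> = - 2 * of_nat k * (LINT x|lborel. g x * f x * of_real (v (x \<bullet> x)))"
    by (rule Green_identity_radial_weight[OF g f homg harmg w v w0 supp])
  finally have "of_nat j * (LINT x|lborel. f x * g x * of_real (v (x \<bullet> x))) = of_nat k * (LINT x|lborel. f x * g x * of_real (v (x \<bullet> x)))"
    by (simp add: mult.commute)
  then show ?thesis using \<open>j \<noteq> k\<close> by simp
qed

section \<open>Integration over the sphere\<close>

lemma space_sphere_measure: "space (sphere_measure :: 'a::euclidean_space measure) = sphere 0 1"
  by (simp add: sphere_measure_def space_restrict_space)

lemma radial_projection_measurable:
  "(\<lambda>x::'a::euclidean_space. x /\<^sub>R norm x) \<in>
     restrict_space lborel (cball 0 1 - {0}) \<rightarrow>\<^sub>M restrict_space borel (sphere 0 1)"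
proof (rule measurable_restrict_space2)
  show "(\<lambda>x::'a. x /\<^sub>R norm x) \<in> restrict_space lborel (cball 0 1 - {0}) \<rightarrow>\<^sub>M borel"
    by (rule measurable_restrict_space1) simp
qed (auto simp: space_restrict_space)

text \<open>
  In terms of a density the integration rules for image measures and densities become applicable.
\<close>

lemma sphere_measure_eq_density:
  "(sphere_measure :: 'a::euclidean_space measure) =
     distr (density (restrict_space lborel (cball 0 1 - {0})) (\<lambda>_. ennreal (real DIM('a))))
       (restrict_space borel (sphere 0 1)) (\<lambda>x. x /\<^sub>R norm x)"
proof -
  have "scale_measure (of_nat DIM('a)) (restrict_space lborel (cball 0 1 - {0}))
      = density (restrict_space lborel (cball 0 1 - {0::'a})) (\<lambda>_. ennreal (real DIM('a)))"
    by (rule measure_eqI) (auto simp: emeasure_density_const ennreal_of_nat_eq_real_of_nat)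
  then show ?thesis by (simp add: sphere_measure_def)
qed

lemma finite_measure_sphere_measure: "finite_measure (sphere_measure :: 'a::euclidean_space measure)"
proof -
  let ?R = "restrict_space lborel (cball 0 1 - {0::'a})"
  let ?D = "density ?R (\<lambda>_. ennreal (real DIM('a)))"
  have "emeasure ?R (space ?R) \<le> emeasure lborel (cball 0 1 :: 'a set)"
    by (subst emeasure_restrict_space) (auto simp: space_restrict_space intro!: emeasure_mono)
  also have "\<dots> < \<infinity>" by (rule emeasure_lborel_cball_finite)
  finally have "emeasure ?R (space ?R) < \<infinity>" .
  then have "emeasure ?D (space ?R) < \<infinity>"
    by (subst emeasure_density_const) (rule sets.top, simp add: ennreal_mult_less_top)
  then have "finite_measure ?D" by (intro finite_measureI) auto
  moreover have "(\<lambda>x::'a. x /\<^sub>R norm x) \<in> ?D \<rightarrow>\<^sub>M restrict_space borel (sphere 0 1)"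
    using radial_projection_measurable[where 'a='a] by (simp cong: measurable_cong_sets)
  ultimately show ?thesis
    unfolding sphere_measure_eq_density by (rule finite_measure.finite_measure_distr)
qed

lemma bounded_on_unit_sphere:
  fixes p :: "'a::euclidean_space \<Rightarrow> 'b::euclidean_space"
  assumes "continuous_on UNIV p"
  obtains B where "0 \<le> B" "\<And>x. norm x = 1 \<Longrightarrow> norm (p x) \<le> B"
proof -
  have "bounded (p ` sphere 0 1)"
    by (intro compact_imp_bounded compact_continuous_image continuous_on_subset[OF assms]) auto
  then obtain B where "\<forall>y \<in> p ` sphere 0 1. norm y \<le> B" by (auto simp: bounded_iff)
  then have "norm (p x) \<le> max B 0" if "norm x = 1" for x
    using that by (simp add: le_max_iff_disj)
  then show ?thesis using that[of "max B 0"] by simp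
qed

lemma borel_measurable_degree_0_extension:
  fixes p :: "'a::euclidean_space \<Rightarrow> 'b::euclidean_space"
  assumes "continuous_on UNIV p"
  shows "(\<lambda>x. indicator (cball 0 1 - {0}) x *\<^sub>R p (x /\<^sub>R norm x)) \<in> borel_measurable lborel"
proof -
  have "(\<lambda>x. p (x /\<^sub>R norm x)) \<in> borel_measurable borel"
    by (rule measurable_compose[OF _ borel_measurable_continuous_onI[OF assms]]) simp
  then show ?thesis
    by (intro borel_measurable_scaleR borel_measurable_indicator) auto
qed

lemma measurable_sphere_measure:
  "continuous_on UNIV p \<Longrightarrow> p \<in> borel_measurable (sphere_measure :: 'a::euclidean_space measure)"
  using measurable_restrict_space1[OF borel_measurable_continuous_onI, of p "sphere 0 1"]
  by (simp add: sphere_measure_def)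

lemma integrable_sphere_measure:
  fixes p :: "'a::euclidean_space \<Rightarrow> 'b::euclidean_space"
  assumes "continuous_on UNIV p"
  shows "integrable sphere_measure p"
proof -
  interpret finite_measure "sphere_measure :: 'a measure" by (rule finite_measure_sphere_measure)
  obtain B where "\<And>x. norm x = 1 \<Longrightarrow> norm (p x) \<le> B"
    using bounded_on_unit_sphere[OF assms] by metis
  then show ?thesis
    by (intro integrable_const_bound[where B = B] measurable_sphere_measure assms AE_I2) (simp add: space_sphere_measure)
qed

lemma sphere_integral_polar:
  fixes p :: "'a::euclidean_space \<Rightarrow> 'b::euclidean_space"
  assumes "continuous_on UNIV p"
  shows "(LINT x|sphere_measure. p x) =
     DIM('a) *\<^sub>R (LINT x|lborel. indicator (cball 0 1 - {0}) x *\<^sub>R p (x /\<^sub>R norm x))"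
proof -
  let ?R = "restrict_space lborel (cball 0 1 - {0::'a})"
  have pm: "p \<in> borel_measurable (restrict_space borel (sphere 0 1))"
    by (intro measurable_restrict_space1 borel_measurable_continuous_onI assms)
  have pm': "(\<lambda>x. p (x /\<^sub>R norm x)) \<in> borel_measurable ?R"
    by (rule measurable_compose[OF radial_projection_measurable pm])
  have "(LINT x|sphere_measure. p x) = (LINT x|density ?R (\<lambda>_. ennreal (real DIM('a))). p (x /\<^sub>R norm x))"
    unfolding sphere_measure_eq_density using radial_projection_measurable[where 'a='a] pm
    by (subst integral_distr) (auto cong: measurable_cong_sets)
  also have "\<dots> = (LINT x|?R. real DIM('a) *\<^sub>R p (x /\<^sub>R norm x))"
    using pm' by (subst integral_density) auto
  also have "\<dots> = DIM('a) *\<^sub>R (LINT x|?R. p (x /\<^sub>R norm x))" by simp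
  also have "(LINT x|?R. p (x /\<^sub>R norm x)) = (LINT x|lborel. indicator (cball 0 1 - {0}) x *\<^sub>R p (x /\<^sub>R norm x))"
    by (rule integral_restrict_space) simp
  finally show ?thesis .
qed

text \<open>
  If \<open>p\<close> does not vanish at \<open>x0\<close>, its extension of degree \<open>0\<close> does not vanish on an open cone around
  the ray through \<open>x0\<close>.
\<close>

lemma sphere_integral_pos:
  fixes p :: "'a::euclidean_space \<Rightarrow> real"
  assumes cont: "continuous_on UNIV p" and nonneg: "\<And>x. 0 \<le> p x" and x0: "norm x0 = 1" "p x0 \<noteq> 0"
  shows "0 < (LINT x|sphere_measure. p x)"
proof -
  let ?F = "\<lambda>x::'a. indicator (cball 0 1 - {0}) x *\<^sub>R p (x /\<^sub>R norm x)"
  have meas: "?F \<in> borel_measurable lborel" by (rule borel_measurable_degree_0_extension[OF cont])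
  obtain B where B: "0 \<le> B" "\<And>x. norm x = 1 \<Longrightarrow> norm (p x) \<le> B"
    using bounded_on_unit_sphere[OF cont] by metis
  have int: "integrable lborel ?F"
  proof (rule Bochner_Integration.integrable_bound[OF _ meas AE_I2])
    show "integrable lborel (\<lambda>x::'a. B * indicator (cball 0 1) x)"
      by (intro integrable_mult_right integrable_real_indicator)
        (auto simp: emeasure_lborel_cball_finite[unfolded infinity_ennreal_def])
    fix x :: 'a
    show "norm (?F x) \<le> norm (B * indicator (cball 0 1) x)"
      using B(1) B(2)[of "x /\<^sub>R norm x"] by (auto simp: indicator_def)
  qed
  define U where "U = {x \<in> ball 0 1 - {0::'a}. p (x /\<^sub>R norm x) \<noteq> 0}"
  have "open U"
  proof -
    have "continuous_on (ball 0 1 - {0}) (\<lambda>x. p (x /\<^sub>R norm x))"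
      by (rule continuous_on_compose2[OF cont]) (auto intro!: continuous_intros)
    from continuous_open_preimage[OF this, of "- {0}"] show ?thesis
      by (simp add: U_def vimage_def Int_def conj_commute open_Diff open_Compl)
  qed
  moreover have "(1 / 2) *\<^sub>R x0 \<in> U"
    using x0 by (simp add: U_def) auto
  ultimately have pos: "\<not> negligible U"
    using open_not_negligible by blast
  have "(LINT x|lborel. ?F x) \<noteq> 0"
  proof
    assume "(LINT x|lborel. ?F x) = 0"
    then have "AE x in lborel. ?F x = 0"
      using integral_nonneg_eq_0_iff_AE[OF int] nonneg by auto
    then have "AE x in lborel. x \<notin> U"
      by eventually_elim (auto simp: U_def indicator_def)
    then have "U \<in> null_sets lborel"
      using \<open>open U\<close> by (subst AE_iff_null_sets) auto
    then have "negligible U"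
      by (simp add: negligible_iff_null_sets null_sets_completionI)
    with pos show False by simp
  qed
  moreover have "(LINT x|lborel. ?F x) \<ge> 0"
    using nonneg by (intro Bochner_Integration.integral_nonneg) auto
  ultimately show ?thesis
    unfolding sphere_integral_polar[OF cont] by (simp add: less_le)
qed

text \<open>
  The integral over the sphere is the integral over the ball of the extension of \<open>f * g\<close> that is
  homogeneous of degree \<open>0\<close>, that is of \<open>f * g\<close> with the radial weight \<open>\<bar>x\<bar> powr (- m)\<close>, \<open>m = j + k\<close>.
  This weight is singular at the origin and does not vanish on the boundary, but it is the limit of
  continuous weights that are covered by the previous lemma, and \<open>f * g\<close> is of order \<open>\<bar>x\<bar> powr m\<close>,
  so that dominated convergence applies.
\<close>

lemma sphere_orthogonal:
  fixes f g :: "'a::euclidean_space \<Rightarrow> complex"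
  assumes f: "polynomial_function f" and g: "polynomial_function g"
    and homf: "\<And>c x. f (c *\<^sub>R x) = c ^ j *\<^sub>R f x" and homg: "\<And>c x. g (c *\<^sub>R x) = c ^ k *\<^sub>R g x"
    and harmf: "\<And>x. (\<Sum>b\<in>Basis. frechet_derivative (\<lambda>y. frechet_derivative f (at y) b) (at x) b) = 0"
    and harmg: "\<And>x. (\<Sum>b\<in>Basis. frechet_derivative (\<lambda>y. frechet_derivative g (at y) b) (at x) b) = 0"
    and "j \<noteq> k"
  shows "(LINT x|sphere_measure. f x * g x) = 0"
proof -
  define F where "F x = f x * g x" for x
  define m where "m = real (j + k)"
  have contF: "continuous_on UNIV F"
    unfolding F_def by (intro continuous_intros continuous_on_polymonial_function f g)
  have homF: "F (c *\<^sub>R x) = c ^ (j + k) *\<^sub>R F x" for c x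
    by (simp add: F_def homf homg power_add)
  have F_polar: "F x = (norm x powr m) *\<^sub>R F (x /\<^sub>R norm x)" if "x \<noteq> 0" for x
  proof -
    have "x = norm x *\<^sub>R (x /\<^sub>R norm x)" using that by simp
    then have "F x = norm x ^ (j + k) *\<^sub>R F (x /\<^sub>R norm x)" by (metis homF)
    also have "norm x ^ (j + k) = norm x powr m" unfolding m_def using that by (intro powr_realpow[symmetric]) simp
    finally show ?thesis .
  qed
  obtain B where B: "0 \<le> B" "\<And>x. norm x = 1 \<Longrightarrow> norm (F x) \<le> B"
    using bounded_on_unit_sphere[OF contF] by metis
  have powt: "(x \<bullet> x) powr (- m / 2) = norm x powr (- m)" if "x \<noteq> 0" for x :: 'a
  proof -
    have "x \<bullet> x = norm x powr 2" using that by (simp add: powr_numeral dot_square_norm)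
    then have "(x \<bullet> x) powr (- m / 2) = norm x powr (2 * (- m / 2))" by (simp only: powr_powr)
    then show ?thesis by simp
  qed
  \<comment> \<open>The shift by \<open>1 / Suc n\<close> removes the singularity at \<open>0\<close>, the second factor is a cutoff at \<open>1\<close>; \<open>max t 0\<close> only makes \<open>v n\<close> continuous on the whole line.\<close>
  define v where "v n t = (max t 0 + 1 / real (Suc n)) powr (- m / 2) * max 0 (min 1 (real (Suc n) * (1 - t)))" for n t
  have contv: "continuous_on UNIV (v n)" for n
  proof -
    have "max t 0 + 1 / real (Suc n) \<noteq> 0" for t
      by (smt (verit) of_nat_0_less_iff zero_less_Suc zero_less_divide_1_iff)
    then show ?thesis
      unfolding v_def by (intro continuous_intros) auto
  qed
  have suppv: "v n t = 0" if "1 \<le> t" for n t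
  proof -
    have "real (Suc n) * (1 - t) \<le> 0" using that by (intro mult_nonneg_nonpos) auto
    then show ?thesis unfolding v_def by (simp only: max_def min_def) auto
  qed
  have zero: "(LINT x|lborel. F x * of_real (v n (x \<bullet> x))) = 0" for n
    unfolding F_def
    by (rule harmonic_orthogonal_radial_weight[OF f g homf homg harmf harmg \<open>j \<noteq> k\<close> contv suppv])
  let ?G = "\<lambda>x::'a. indicator (cball 0 1 - {0}) x *\<^sub>R F (x /\<^sub>R norm x)"
  have "(\<lambda>n. LINT x|lborel. F x * of_real (v n (x \<bullet> x))) \<longlonglongrightarrow> (LINT x|lborel. ?G x)"
  proof (rule integral_dominated_convergence)
    show "?G \<in> borel_measurable lborel" by (rule borel_measurable_degree_0_extension[OF contF])
    show "(\<lambda>x. F x * of_real (v n (x \<bullet> x))) \<in> borel_measurable lborel" for n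
    proof -
      have "continuous_on UNIV (\<lambda>x. F x * of_real (v n (x \<bullet> x)))"
        by (intro continuous_intros contF continuous_on_compose2[OF contv]) auto
      then show ?thesis using borel_measurable_continuous_onI by simp
    qed
    show "integrable lborel (\<lambda>x::'a. B * indicator (cball 0 1) x)"
      by (intro integrable_mult_right integrable_real_indicator)
        (auto simp: emeasure_lborel_cball_finite[unfolded infinity_ennreal_def])
    have ae: "AE x in lborel. x \<noteq> (0::'a) \<and> norm x \<noteq> 1"
    proof -
      have "sphere 0 1 \<in> null_sets (lborel :: 'a measure)"
        using negligible_sphere[of "0::'a" 1] by (simp add: negligible_iff_null_sets null_sets_completion_iff)
      then have "AE x in lborel. x \<notin> sphere (0::'a) 1" by (rule AE_not_in)
      moreover have "AE x in lborel. x \<noteq> (0::'a)" by (rule AE_lborel_singleton)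
      ultimately show ?thesis by eventually_elim auto
    qed
    show "AE x in lborel. (\<lambda>n. F x * of_real (v n (x \<bullet> x))) \<longlonglongrightarrow> ?G x"
      using ae
    proof eventually_elim
      case (elim x)
      show ?case
      proof (cases "norm x < 1")
        case True
        define t where "t = x \<bullet> x"
        have t: "0 < t" "t < 1" "t = (norm x)\<^sup>2"
          using elim True by (auto simp: t_def dot_square_norm power_less_one_iff)
        have "(\<lambda>n. v n t) \<longlonglongrightarrow> t powr (- m / 2)"
        proof -
          have a: "(\<lambda>n. (t + 1 / real (Suc n)) powr (- m / 2)) \<longlonglongrightarrow> t powr (- m / 2)"
          proof -
            have "(\<lambda>n. t + 1 / real (Suc n)) \<longlonglongrightarrow> t + 0"
              using LIMSEQ_inverse_real_of_nat by (intro tendsto_intros) (simp add: inverse_eq_divide)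
            then show ?thesis using t by (intro tendsto_powr) auto
          qed
          have b: "(\<lambda>n. max 0 (min 1 (real (Suc n) * (1 - t)))) \<longlonglongrightarrow> 1"
          proof (rule tendsto_eventually)
            obtain N where N: "1 / (1 - t) < real N" using reals_Archimedean2 by blast
            have "max 0 (min 1 (real (Suc n) * (1 - t))) = 1" if "n \<ge> N" for n
            proof -
              have "1 / (1 - t) \<le> real (Suc n)" using N that by simp
              then have "1 \<le> real (Suc n) * (1 - t)" using t by (simp add: divide_le_eq)
              then show ?thesis by simp
            qed
            then show "\<forall>\<^sub>F n in sequentially. max 0 (min 1 (real (Suc n) * (1 - t))) = 1"
              by (auto simp: eventually_sequentially)
          qed
          show ?thesis
            using tendsto_mult[OF a b] t by (simp add: v_def max_def)
        qed
        then have "(\<lambda>n. F x * of_real (v n t)) \<longlonglongrightarrow> F x * of_real (t powr (- m / 2))"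
          by (intro tendsto_intros)
        also have "t powr (- m / 2) = norm x powr (- m)"
          using powt[of x] elim by (simp add: t_def)
        also have "F x * of_real (norm x powr - m) = F (x /\<^sub>R norm x)"
        proof -
          have "norm x powr m * norm x powr (- m) = 1" using elim by (simp flip: powr_add)
          then show ?thesis
            using F_polar[of x] elim by (simp add: scaleR_conv_of_real mult_ac flip: of_real_mult)
        qed
        finally show ?thesis using True elim by (simp add: t_def)
      next
        case False
        then have "norm x > 1" using elim by simp
        then have "x \<bullet> x \<ge> 1" using one_le_power[of "norm x" 2] by (simp add: dot_square_norm)
        then show ?thesis using \<open>norm x > 1\<close> by (simp add: suppv)
      qed
    qed
    show "AE x in lborel. norm (F x * of_real (v n (x \<bullet> x))) \<le> B * indicator (cball 0 1) x" for n
      using ae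
    proof eventually_elim
      case (elim x)
      show ?case
      proof (cases "norm x < 1")
        case True
        define t where "t = x \<bullet> x"
        have t: "0 < t" "t < 1" "t = (norm x)\<^sup>2"
          using elim True by (auto simp: t_def dot_square_norm power_less_one_iff)
        have "v n t \<le> (t + 1 / real (Suc n)) powr (- m / 2) * 1"
          unfolding v_def using t by (intro mult_mono) auto
        also have "\<dots> \<le> t powr (- m / 2)"
          using t by (simp add: powr_mono2' m_def)
        also have "\<dots> = norm x powr (- m)"
          using powt[of x] elim by (simp add: t_def)
        finally have vle: "v n t \<le> norm x powr (- m)" .
        have "norm (F x * of_real (v n t)) = norm (F (x /\<^sub>R norm x)) * (norm x powr m * v n t)"
          using F_polar[of x] elim by (simp add: norm_mult v_def)
        also have "\<dots> \<le> B * (norm x powr m * norm x powr (- m))"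
          using elim vle B by (intro mult_mono) (auto simp: v_def)
        also have "norm x powr m * norm x powr (- m) = 1" using elim by (simp flip: powr_add)
        finally show ?thesis using True by (simp add: t_def)
      next
        case False
        then have "norm x > 1" using elim by simp
        then have "x \<bullet> x \<ge> 1" using one_le_power[of "norm x" 2] by (simp add: dot_square_norm)
        then show ?thesis using B by (simp add: suppv)
      qed
    qed
  qed
  then have "(LINT x|lborel. ?G x) = 0"
    unfolding zero by (simp add: LIMSEQ_const_iff)
  then show ?thesis
    using sphere_integral_polar[OF contF] by (simp add: F_def)
qed

section \<open>Spherical harmonics and multipliers\<close>

definition harmonic_polynomial :: "nat \<Rightarrow> ('a::euclidean_space \<Rightarrow> complex) \<Rightarrow> bool" where
  "harmonic_polynomial j p \<longleftrightarrow> polynomial_function p \<and> (\<forall>c x. p (c *\<^sub>R x) = c ^ j *\<^sub>R p x) \<and>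
     (\<forall>x. euclidean_laplacian p x = 0)"

text \<open>
  Spherical harmonics are handled through their polynomials: those can be differentiated and
  integrated, and \<open>sphere_restrict\<close> turns them into functions that vanish off the sphere.
\<close>

definition sphere_restrict :: "('a::euclidean_space \<Rightarrow> complex) \<Rightarrow> 'a \<Rightarrow> complex" where
  "sphere_restrict p x = (if x \<in> sphere 0 1 then p x else 0)"

lemma spherical_harmonics_eq: "spherical_harmonics j = sphere_restrict ` Collect (harmonic_polynomial j)"
  by (auto simp: spherical_harmonics_def harmonic_polynomial_def sphere_restrict_def[abs_def] image_def)

lemma euclidean_laplacian_bounded_linear:
  assumes "bounded_linear L" and p: "polynomial_function p"
  shows "euclidean_laplacian (\<lambda>x. L (p x)) x = L (euclidean_laplacian p x)"
proof -
  have *: "frechet_derivative (\<lambda>x. L (q x)) (at y) h = L (frechet_derivative q (at y) h)"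
    if "polynomial_function q" for q :: "'a \<Rightarrow> complex" and y h
    using frechet_derivative_at[OF bounded_linear.has_derivative[OF assms(1) has_derivative_polynomial_function[OF that]]]
    by metis
  show ?thesis
    by (simp add: euclidean_laplacian_def * p polynomial_function_frechet_derivative
        linear_sum[OF bounded_linear.linear[OF assms(1)]])
qed

lemma euclidean_laplacian_diff:
  assumes p: "polynomial_function p" and q: "polynomial_function q"
  shows "euclidean_laplacian (\<lambda>x. p x - q x) x = euclidean_laplacian p x - euclidean_laplacian q x"
proof -
  have *: "frechet_derivative (\<lambda>x. p x - q x) (at y) h = frechet_derivative p (at y) h - frechet_derivative q (at y) h"
    if "polynomial_function p" "polynomial_function q" for p q :: "'a \<Rightarrow> complex" and y h
    using frechet_derivative_at[OF has_derivative_diff[OF that[THEN has_derivative_polynomial_function]]]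
    by metis
  show ?thesis
    by (simp add: euclidean_laplacian_def * p q polynomial_function_frechet_derivative sum_subtractf)
qed

lemma polynomial_function_linear_compose:
  fixes p :: "'a::euclidean_space \<Rightarrow> complex" and L :: "complex \<Rightarrow> complex"
  assumes "bounded_linear L" "polynomial_function p"
  shows "polynomial_function (\<lambda>x. L (p x))"
  using polynomial_function_compose[OF assms(2) polynomial_function_bounded_linear[OF assms(1)]]
  by (simp add: o_def)

lemma harmonic_polynomial_linear:
  assumes "bounded_linear L" "harmonic_polynomial j p"
  shows "harmonic_polynomial j (\<lambda>x. L (p x))"
  using assms linear_scale[OF bounded_linear.linear[OF assms(1)]] linear_0[OF bounded_linear.linear[OF assms(1)]]
  by (simp add: harmonic_polynomial_def euclidean_laplacian_bounded_linear polynomial_function_linear_compose)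

lemma harmonic_polynomial_diff:
  assumes "harmonic_polynomial j p" "harmonic_polynomial j q"
  shows "harmonic_polynomial j (\<lambda>x. p x - q x)"
  using assms by (auto simp: harmonic_polynomial_def euclidean_laplacian_diff scaleR_diff_right)

lemma harmonic_polynomial_0: "harmonic_polynomial j (\<lambda>_. 0)"
  by (simp add: harmonic_polynomial_def euclidean_laplacian_def)

lemma continuous_harmonic_polynomial: "harmonic_polynomial j p \<Longrightarrow> continuous_on UNIV p"
  by (simp add: harmonic_polynomial_def continuous_on_polymonial_function)

lemma sphere_inner_restrict:
  "sphere_inner (sphere_restrict p) (sphere_restrict q) = (LINT x|sphere_measure. p x * cnj (q x))"
  unfolding sphere_inner_def
  by (rule Bochner_Integration.integral_cong) (auto simp: space_sphere_measure sphere_restrict_def)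

lemma sphere_L2_norm_restrict:
  "sphere_L2_norm (sphere_restrict p) = sqrt (LINT x|sphere_measure. (cmod (p x))\<^sup>2)"
  unfolding sphere_L2_norm_def
  by (rule arg_cong[where f = sqrt], rule Bochner_Integration.integral_cong)
    (auto simp: space_sphere_measure sphere_restrict_def)

lemma sphere_L2_norm_scaleR: "sphere_L2_norm (\<lambda>x. c *\<^sub>R Y x) = \<bar>c\<bar> * sphere_L2_norm Y"
  by (simp add: sphere_L2_norm_def power_mult_distrib real_sqrt_mult)

lemma sphere_L2_norm_0 [simp]: "sphere_L2_norm (\<lambda>_. 0) = 0"
  by (simp add: sphere_L2_norm_def)

lemma sphere_inner_self:
  "sphere_inner (sphere_restrict p) (sphere_restrict p) = of_real (LINT x|sphere_measure. (cmod (p x))\<^sup>2)"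
  unfolding sphere_inner_restrict by (simp add: complex_norm_square[symmetric] flip: of_real_power)

lemma sphere_restrict_eq_0_if_L2_norm_eq_0:
  fixes p :: "'a::euclidean_space \<Rightarrow> complex"
  assumes cont: "continuous_on UNIV p" and "(LINT x|sphere_measure. (cmod (p x))\<^sup>2) = 0"
  shows "sphere_restrict p = (\<lambda>_. 0)"
proof (rule ccontr)
  assume "sphere_restrict p \<noteq> (\<lambda>_. 0)"
  then obtain x0 where "norm x0 = 1" "p x0 \<noteq> 0"
    by (auto simp: sphere_restrict_def fun_eq_iff split: if_splits)
  then have "0 < (LINT x|sphere_measure. (cmod (p x))\<^sup>2)"
    by (intro sphere_integral_pos[of _ x0]) (auto intro!: continuous_intros cont)
  then show False using assms(2) by simp
qed

lemma spherical_harmonics_orthogonal: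
  assumes "Y \<in> spherical_harmonics j" "Z \<in> spherical_harmonics k" "j \<noteq> k"
  shows "sphere_inner Y Z = 0"
proof -
  obtain p q where p: "Y = sphere_restrict p" "harmonic_polynomial j p"
    and q: "Z = sphere_restrict q" "harmonic_polynomial k q"
    using assms by (auto simp: spherical_harmonics_eq)
  have "harmonic_polynomial k (\<lambda>x. cnj (q x))"
    by (rule harmonic_polynomial_linear[OF bounded_linear_cnj q(2)])
  then show ?thesis
    unfolding p(1) q(1) sphere_inner_restrict using p(2) assms(3)
    by (intro sphere_orthogonal[where j = j and k = k])
      (auto simp: harmonic_polynomial_def euclidean_laplacian_def)
qed

text \<open>
  The difference of two candidates for the projection is a spherical harmonic of degree \<open>j\<close>
  orthogonal to itself, and a continuous function of norm \<open>0\<close> vanishes on the sphere.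
\<close>

lemma harmonic_projection_eqI:
  assumes f: "continuous_on UNIV f" and h: "h \<in> spherical_harmonics j"
    and orth: "\<And>Y. Y \<in> spherical_harmonics j \<Longrightarrow> sphere_inner (\<lambda>x. sphere_restrict f x - h x) Y = 0"
  shows "harmonic_projection j (sphere_restrict f) = h"
  unfolding harmonic_projection_def
proof (rule the_equality)
  fix h' assume h': "h' \<in> spherical_harmonics j \<and> (\<forall>Y\<in>spherical_harmonics j. sphere_inner (\<lambda>x. sphere_restrict f x - h' x) Y = 0)"
  obtain p p' where p: "h = sphere_restrict p" "harmonic_polynomial j p"
    and p': "h' = sphere_restrict p'" "harmonic_polynomial j p'"
    using h h' by (auto simp: spherical_harmonics_eq)
  define q where "q x = p' x - p x" for x
  have q: "harmonic_polynomial j q"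
    unfolding q_def by (intro harmonic_polynomial_diff p p')
  have diff: "(\<lambda>x. sphere_restrict f x - sphere_restrict r x) = sphere_restrict (\<lambda>x. f x - r x)" for r
    by (auto simp: sphere_restrict_def)
  note cont = f p(2)[THEN continuous_harmonic_polynomial] p'(2)[THEN continuous_harmonic_polynomial] q[THEN continuous_harmonic_polynomial]
  have qj: "sphere_restrict q \<in> spherical_harmonics j" using q by (auto simp: spherical_harmonics_eq)
  have 1: "(LINT x|sphere_measure. (f x - p x) * cnj (q x)) = 0"
    using orth[OF qj] by (simp add: p diff sphere_inner_restrict)
  have 2: "(LINT x|sphere_measure. (f x - p' x) * cnj (q x)) = 0"
    using h'[THEN conjunct2, rule_format, OF qj] by (simp add: p' diff sphere_inner_restrict)
  have "(LINT x|sphere_measure. q x * cnj (q x)) = (LINT x|sphere_measure. (f x - p x) * cnj (q x) - (f x - p' x) * cnj (q x))"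
    by (simp add: q_def algebra_simps)
  also have "\<dots> = 0"
    by (subst Bochner_Integration.integral_diff) (auto simp: 1 2 intro!: integrable_sphere_measure continuous_intros cont)
  finally have "sphere_inner (sphere_restrict q) (sphere_restrict q) = 0"
    by (simp add: sphere_inner_restrict)
  then have "sphere_restrict q = (\<lambda>_. 0)"
    using cont by (intro sphere_restrict_eq_0_if_L2_norm_eq_0) (auto simp: sphere_inner_self)
  then show "h' = h"
    by (auto simp: p p' sphere_restrict_def q_def fun_eq_iff split: if_splits)
qed (use h orth in auto)

lemma zero_in_spherical_harmonics: "(\<lambda>_. 0) \<in> spherical_harmonics j"
proof -
  have "sphere_restrict (\<lambda>_. 0) \<in> spherical_harmonics j"
    using harmonic_polynomial_0 by (auto simp: spherical_harmonics_eq)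
  then show ?thesis by (simp add: sphere_restrict_def[abs_def])
qed

text \<open>
  In degree \<open>j\<close> the residual \<open>Y - Y\<close> is \<open>0\<close>; in the other degrees \<open>0\<close> is the projection since
  spherical harmonics of different degrees are orthogonal.
\<close>

lemma harmonic_projection_spherical_harmonic:
  assumes "Y \<in> spherical_harmonics j"
  shows "harmonic_projection k Y = (if k = j then Y else (\<lambda>_. 0))"
proof -
  obtain p where p: "Y = sphere_restrict p" "harmonic_polynomial j p"
    using assms by (auto simp: spherical_harmonics_eq)
  note c = continuous_harmonic_polynomial[OF p(2)]
  show ?thesis
  proof (cases "k = j")
    case True
    have "harmonic_projection j (sphere_restrict p) = Y"
      by (rule harmonic_projection_eqI[OF c assms]) (simp add: p sphere_inner_def)
    then show ?thesis using True p by simp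
  next
    case False
    have "harmonic_projection k (sphere_restrict p) = (\<lambda>_. 0)"
      using spherical_harmonics_orthogonal[OF assms _ False[symmetric]]
      by (intro harmonic_projection_eqI[OF c zero_in_spherical_harmonics]) (simp add: p)
    then show ?thesis using False p by simp
  qed
qed

lemma sobolev_norm_spherical_harmonic:
  fixes Y :: "'a::euclidean_space \<Rightarrow> complex"
  assumes "Y \<in> spherical_harmonics j" and "DIM('a) \<ge> 2"
  shows "sobolev_norm s Y = (1 + real j * (real j + real (sphere_dim TYPE('a)) - 1)) powr (s / 2) * sphere_L2_norm Y"
proof -
  define l where "l = 1 + real j * (real j + real (sphere_dim TYPE('a)) - 1)"
  have "real (sphere_dim TYPE('a)) \<ge> 1" using assms(2) by (simp add: sphere_dim_def)
  then have "0 \<le> real j * (real j + real (sphere_dim TYPE('a)) - 1)" by (intro mult_nonneg_nonneg) auto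
  then have l: "l > 0" by (simp add: l_def)
  have nn: "sphere_L2_norm Y \<ge> 0" by (simp add: sphere_L2_norm_def)
  have "(\<lambda>k. (1 + real k * (real k + real (sphere_dim TYPE('a)) - 1)) powr s * (sphere_L2_norm (harmonic_projection k Y))\<^sup>2)
     = (\<lambda>k. if k = j then l powr s * (sphere_L2_norm Y)\<^sup>2 else 0)"
    by (auto simp: harmonic_projection_spherical_harmonic[OF assms(1)] l_def)
  moreover have "\<dots> sums (l powr s * (sphere_L2_norm Y)\<^sup>2)"
    using sums_single[of j "\<lambda>_. l powr s * (sphere_L2_norm Y)\<^sup>2"] by simp
  ultimately have "sobolev_norm s Y = sqrt (l powr s * (sphere_L2_norm Y)\<^sup>2)"
    by (simp add: sobolev_norm_def sums_unique[symmetric])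
  also have "\<dots> = l powr (s / 2) * sphere_L2_norm Y"
    using nn l by (simp add: real_sqrt_mult powr_half_sqrt[symmetric] powr_powr)
  finally show ?thesis by (simp add: l_def)
qed

lemma spherical_multiplier_spherical_harmonic:
  assumes "Y \<in> spherical_harmonics j"
  shows "spherical_multiplier \<mu> Y = (\<lambda>x. \<mu> j *\<^sub>R Y x)"
proof
  fix x
  have "(\<lambda>k. \<mu> k *\<^sub>R harmonic_projection k Y x) = (\<lambda>k. if k = j then \<mu> j *\<^sub>R Y x else 0)"
    by (auto simp: harmonic_projection_spherical_harmonic[OF assms])
  moreover have "\<dots> sums (\<mu> j *\<^sub>R Y x)"
    using sums_single[of j "\<lambda>_. \<mu> j *\<^sub>R Y x"] by simp
  ultimately show "spherical_multiplier \<mu> Y x = \<mu> j *\<^sub>R Y x"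
    by (simp add: spherical_multiplier_def sums_unique[symmetric])
qed

lemma polynomial_function_mult_complex:
  fixes f g :: "'a::euclidean_space \<Rightarrow> complex"
  assumes "polynomial_function f" "polynomial_function g"
  shows "polynomial_function (\<lambda>x. f x * g x)"
  using assms by (auto simp: polynomial_function_iff_Basis_inner Basis_complex_def inner_complex_def)

text \<open>
  A witness is \<open>(x\<^sub>1 + \<i> * x\<^sub>2) ^ j\<close>. It is harmonic since the complex vector \<open>(1, \<i>, 0, \<dots>)\<close> is
  isotropic: the sum of the squares of its coordinates is \<open>0\<close>.
\<close>

lemma nonzero_spherical_harmonic_exists:
  assumes "DIM('a::euclidean_space) \<ge> 2"
  obtains Y :: "'a::euclidean_space \<Rightarrow> complex" where "Y \<in> spherical_harmonics j" "sphere_L2_norm Y > 0"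
proof -
  obtain b1 b2 :: 'a where b: "b1 \<in> Basis" "b2 \<in> Basis" "b1 \<noteq> b2"
  proof -
    have "\<exists>b1\<in>(Basis :: 'a set). \<exists>b2\<in>Basis. b1 \<noteq> b2"
      using assms card_le_Suc0_iff_eq[of "Basis :: 'a set"] by auto
    then show ?thesis using that by blast
  qed
  define z where "z x = complex_of_real (x \<bullet> b1) + \<i> * complex_of_real (x \<bullet> b2)" for x
  have z_der: "(z has_derivative z) (at x)" for x
    unfolding z_def[abs_def] by (auto intro!: derivative_eq_intros)
  have pow_der: "frechet_derivative (\<lambda>x. c * z x ^ k) (at x) h = c * (of_nat k * z h * z x ^ (k - 1))" for c k x h
  proof -
    have "((\<lambda>x. c * z x ^ k) has_derivative (\<lambda>h. c * (of_nat k * z h * z x ^ (k - 1)))) (at x)"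
      by (auto intro!: derivative_eq_intros z_der)
    from frechet_derivative_at[OF this] show ?thesis by metis
  qed
  define p where "p x = z x ^ j" for x
  have "polynomial_function z"
    unfolding z_def by (auto simp: polynomial_function_iff_Basis_inner Basis_complex_def inner_complex_def
        intro!: real_polynomial_function.intros(1) bounded_linear_inner_left)
  then have "polynomial_function (\<lambda>x. z x ^ k)" for k
    by (induction k) (auto intro: polynomial_function_mult_complex)
  moreover have "p (c *\<^sub>R x) = c ^ j *\<^sub>R p x" for c x
  proof -
    have "z (c *\<^sub>R x) = of_real c * z x" by (simp add: z_def algebra_simps)
    then show ?thesis by (simp add: p_def power_mult_distrib scaleR_conv_of_real)
  qed
  moreover have "euclidean_laplacian p x = 0" for x
  proof -
    have zb: "(\<Sum>b\<in>Basis. (z b)\<^sup>2) = 0"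
    proof -
      have "(z b)\<^sup>2 = (if b = b1 then 1 else 0) + (if b = b2 then -1 else 0)" if "b \<in> Basis" for b
        using that b by (auto simp: z_def inner_Basis)
      then have "(\<Sum>b\<in>Basis. (z b)\<^sup>2) = (\<Sum>b\<in>Basis. (if b = b1 then 1 else 0) + (if b = b2 then -1 else 0))"
        by (intro sum.cong) auto
      also have "\<dots> = 0" using b by (simp add: sum.distrib)
      finally show ?thesis .
    qed
    have d1: "frechet_derivative p (at y) b = (of_nat j * z b) * z y ^ (j - 1)" for y b
      using pow_der[of 1 j y b] by (simp add: p_def[abs_def])
    have "euclidean_laplacian p x = (\<Sum>b\<in>Basis. (of_nat j * of_nat (j - 1) * z x ^ (j - 1 - 1)) * (z b)\<^sup>2)"
      unfolding euclidean_laplacian_def d1 pow_der by (simp add: power2_eq_square mult_ac)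
    also have "\<dots> = 0" unfolding sum_distrib_left[symmetric] zb by simp
    finally show ?thesis .
  qed
  ultimately have hp: "harmonic_polynomial j p"
    by (simp add: harmonic_polynomial_def p_def[abs_def])
  have "p b1 = 1" using b by (simp add: p_def z_def inner_Basis)
  then have "0 < (LINT x|sphere_measure. (cmod (p x))\<^sup>2)"
    using b by (intro sphere_integral_pos[of _ b1])
      (auto intro!: continuous_intros continuous_harmonic_polynomial[OF hp])
  then have "sphere_L2_norm (sphere_restrict p) > 0" by (simp add: sphere_L2_norm_restrict)
  then show ?thesis
    using hp that by (auto simp: spherical_harmonics_eq)
qed

lemma spherical_harmonics_scaleR:
  assumes "Y \<in> spherical_harmonics j" shows "(\<lambda>x. c *\<^sub>R Y x) \<in> spherical_harmonics j"
proof -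
  obtain p where p: "Y = sphere_restrict p" "harmonic_polynomial j p"
    using assms by (auto simp: spherical_harmonics_eq)
  have "(\<lambda>x. c *\<^sub>R Y x) = sphere_restrict (\<lambda>x. c *\<^sub>R p x)" by (auto simp: p sphere_restrict_def)
  then show ?thesis
    using harmonic_polynomial_linear[OF bounded_linear_scaleR_right p(2), of c] by (auto simp: spherical_harmonics_eq)
qed

lemma spherical_harmonics_subset_finite_harmonic_sums:
  assumes "Y \<in> spherical_harmonics j" shows "Y \<in> finite_harmonic_sums"
proof -
  have "Y = (\<lambda>x. \<Sum>i\<le>j. (if i = j then Y else (\<lambda>_. 0)) x)"
    by (simp add: if_distribR)
  moreover have "\<forall>i. (if i = j then Y else (\<lambda>_. 0)) \<in> spherical_harmonics i"
    using assms zero_in_spherical_harmonics by auto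
  ultimately show ?thesis
    unfolding finite_harmonic_sums_def
    by (intro CollectI exI[of _ j] exI[of _ "\<lambda>i. if i = j then Y else (\<lambda>_. 0)"] conjI)
qed

text \<open>
  Test the operator inequality on a single spherical harmonic of degree \<open>j\<close>: the inverse transform
  multiplies it by the inverse eigenvalue, and each Sobolev norm multiplies its \<open>L\<^sup>2\<close> norm by a power
  of \<open>1 + j * (j + n - 1)\<close>.
\<close>

lemma minkowski_funk_inverse_bounded_imp_eigenvalue_bound:
  assumes dim: "DIM('a::euclidean_space) = n + 1" "n \<ge> 1"
    and bdd: "minkowski_funk_inverse_bounded TYPE('a) \<kappa> \<alpha> t \<sigma> s"
  shows "\<exists>C>0. \<forall>j. minkowski_funk_eigenvalue \<kappa> n \<alpha> t j \<noteq> 0 \<and>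
     1 \<le> C * (1 + real j * (real j + real n - 1)) powr ((\<sigma> - s) / 2) * \<bar>minkowski_funk_eigenvalue \<kappa> n \<alpha> t j\<bar>"
proof -
  let ?m = "minkowski_funk_eigenvalue \<kappa> n \<alpha> t"
  have n: "sphere_dim TYPE('a) = n" using dim by (simp add: sphere_dim_def)
  have nz: "?m j \<noteq> 0" for j
    using bdd by (simp add: minkowski_funk_inverse_bounded_def n)
  obtain C where C: "C > 0" "\<And>g :: 'a \<Rightarrow> complex. g \<in> finite_harmonic_sums \<Longrightarrow>
      sobolev_norm s (minkowski_funk_inverse \<kappa> \<alpha> t g) \<le> C * sobolev_norm \<sigma> g"
    using bdd by (auto simp: minkowski_funk_inverse_bounded_def)
  have "1 \<le> C * (1 + real j * (real j + real n - 1)) powr ((\<sigma> - s) / 2) * \<bar>?m j\<bar>" for j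
  proof -
    define l where "l = 1 + real j * (real j + real n - 1)"
    have "0 \<le> real j * (real j + real n - 1)" using dim by (intro mult_nonneg_nonneg) auto
    then have l: "l > 0" by (simp add: l_def)
    obtain Y :: "'a \<Rightarrow> complex" where Y: "Y \<in> spherical_harmonics j" "sphere_L2_norm Y > 0"
      using nonzero_spherical_harmonic_exists[where 'a='a, of j] dim by auto
    have inv: "minkowski_funk_inverse \<kappa> \<alpha> t Y = (\<lambda>x. inverse (?m j) *\<^sub>R Y x)"
      unfolding minkowski_funk_inverse_def n by (rule spherical_multiplier_spherical_harmonic[OF Y(1)])
    have d2: "DIM('a) \<ge> 2" using dim by simp
    have "l powr (s / 2) * (\<bar>inverse (?m j)\<bar> * sphere_L2_norm Y) \<le> C * (l powr (\<sigma> / 2) * sphere_L2_norm Y)"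
      using C(2)[OF spherical_harmonics_subset_finite_harmonic_sums[OF Y(1)]]
      unfolding inv sobolev_norm_spherical_harmonic[OF Y(1) d2]
        sobolev_norm_spherical_harmonic[OF spherical_harmonics_scaleR[OF Y(1)] d2] sphere_L2_norm_scaleR n l_def .
    then have "(l powr (s / 2) * \<bar>inverse (?m j)\<bar>) * sphere_L2_norm Y \<le> (C * l powr (\<sigma> / 2)) * sphere_L2_norm Y"
      by (simp add: mult_ac)
    then have *: "l powr (s / 2) * \<bar>inverse (?m j)\<bar> \<le> C * l powr (\<sigma> / 2)"
      using Y(2) by (rule mult_right_le_imp_le)
    have "l powr (s / 2) = l powr (s / 2) * \<bar>inverse (?m j)\<bar> * \<bar>?m j\<bar>"
      using nz[of j] by (simp add: abs_inverse)
    also have "\<dots> \<le> C * l powr (\<sigma> / 2) * \<bar>?m j\<bar>" by (intro mult_right_mono *) auto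
    also have "l powr (\<sigma> / 2) = l powr ((\<sigma> - s) / 2) * l powr (s / 2)"
      by (simp flip: powr_add add: field_simps)
    finally have "1 * l powr (s / 2) \<le> (C * l powr ((\<sigma> - s) / 2) * \<bar>?m j\<bar>) * l powr (s / 2)"
      by (simp add: mult_ac)
    then show ?thesis using l by (simp add: l_def)
  qed
  then show ?thesis using C nz by blast
qed

section \<open>Small denominators\<close>

lemma abs_sin_le_dist_multiple_pi: "\<bar>sin x\<bar> \<le> \<bar>x - real_of_int k * pi\<bar>"
proof -
  have s: "sin (real_of_int k * pi) = 0" by (simp add: sin_zero_iff_int2)
  then have "\<bar>cos (real_of_int k * pi)\<bar> = 1"
    using sin_cos_squared_add[of "real_of_int k * pi"] by (auto simp: power2_eq_1_iff)
  then have "\<bar>sin x\<bar> = \<bar>sin (x - real_of_int k * pi)\<bar>"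
    by (simp add: sin_diff s abs_mult)
  also have "\<dots> \<le> \<bar>x - real_of_int k * pi\<bar>" by (rule abs_sin_x_le_abs_x)
  finally show ?thesis .
qed

lemma abs_cos_le_dist_odd_multiple_half_pi:
  assumes "odd p" shows "\<bar>cos x\<bar> \<le> \<bar>x - real_of_int p * (pi / 2)\<bar>"
proof -
  obtain k where k: "p = 2 * k + 1" using assms by (rule oddE)
  have "\<bar>cos x\<bar> = \<bar>sin (x - pi / 2)\<bar>" by (simp add: sin_diff)
  also have "\<dots> \<le> \<bar>(x - pi / 2) - real_of_int k * pi\<bar>" by (rule abs_sin_le_dist_multiple_pi)
  also have "(x - pi / 2) - real_of_int k * pi = x - real_of_int p * (pi / 2)" by (simp add: k algebra_simps)
  finally show ?thesis .
qed

text \<open>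
  With \<open>a = j + n / 2\<close> the parameters of the hypergeometric function are \<open>a\<close>, \<open>1 - a\<close> and
  \<open>\<alpha> + n / 2\<close>, which is \<open>1 / 2\<close> or \<open>3 / 2\<close> for the two values of \<open>\<alpha>\<close>; its argument
  \<open>(1 - cos (\<beta> * pi)) / 2\<close> is the square of \<open>sin (\<beta> * pi / 2)\<close>.
\<close>

lemma minkowski_funk_eigenvalue_cos:
  assumes n: "n \<ge> 2" and \<beta>: "0 < \<beta>" "\<beta> < 1"
  shows "minkowski_funk_eigenvalue \<kappa> n ((1 - real n) / 2) (cos (\<beta> * pi)) j * cos (\<beta> * pi / 2)
      = \<kappa> ((1 - real n) / 2) (cos (\<beta> * pi)) * cos (real (2 * j + n - 1) * (\<beta> * pi / 2))"
  and minkowski_funk_eigenvalue_sin: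
    "minkowski_funk_eigenvalue \<kappa> n ((3 - real n) / 2) (cos (\<beta> * pi)) j * sin (\<beta> * pi / 2) * real (2 * j + n - 1)
      = \<kappa> ((3 - real n) / 2) (cos (\<beta> * pi)) * sin (real (2 * j + n - 1) * (\<beta> * pi / 2))"
proof -
  define x where "x = \<beta> * pi / 2"
  define a where "a = real j + real n / 2"
  have x: "\<bar>x\<bar> < pi / 2" using \<beta> by (simp add: x_def abs_mult)
  have z: "(1 - cos (\<beta> * pi)) / 2 = (sin x)\<^sup>2"
    using cos_double_sin[of x] by (simp add: x_def)
  have q: "2 * a - 1 = real (2 * j + n - 1)" using n by (simp add: a_def of_nat_diff)
  then have a: "2 * a \<noteq> 1" "2 * a - 1 \<noteq> 0" using n by auto
  have b: "1 - real n / 2 - real j = 1 - a" by (simp add: a_def)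
  have "gauss_hypergeo a (1 - a) (1 / 2) ((sin x)\<^sup>2) * cos x = cos ((2 * a - 1) * x)"
    unfolding gauss_hypergeo_def by (rule hypergeo_one_half[OF a(1) x])
  moreover have "(1 - real n) / 2 + real n / 2 = 1 / 2" by (simp add: field_simps)
  ultimately show "minkowski_funk_eigenvalue \<kappa> n ((1 - real n) / 2) (cos (\<beta> * pi)) j * cos (\<beta> * pi / 2)
      = \<kappa> ((1 - real n) / 2) (cos (\<beta> * pi)) * cos (real (2 * j + n - 1) * (\<beta> * pi / 2))"
    unfolding minkowski_funk_eigenvalue_def z b a_def[symmetric] x_def[symmetric] q[symmetric]
    by (simp only: mult.assoc)
  have "gauss_hypergeo a (1 - a) (3 / 2) ((sin x)\<^sup>2) * sin x * (2 * a - 1) = sin ((2 * a - 1) * x)"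
    unfolding gauss_hypergeo_def hypergeo_three_halves[OF a(1) x] using a(2) by simp
  moreover have "(3 - real n) / 2 + real n / 2 = 3 / 2" by (simp add: field_simps)
  ultimately show "minkowski_funk_eigenvalue \<kappa> n ((3 - real n) / 2) (cos (\<beta> * pi)) j * sin (\<beta> * pi / 2) * real (2 * j + n - 1)
      = \<kappa> ((3 - real n) / 2) (cos (\<beta> * pi)) * sin (real (2 * j + n - 1) * (\<beta> * pi / 2))"
    unfolding minkowski_funk_eigenvalue_def z b a_def[symmetric] x_def[symmetric] q[symmetric]
    by (simp only: mult.assoc)
qed

lemma Laplace_eigenvalue_le_square:
  assumes "n \<ge> 2"
  shows "1 + real j * (real j + real n - 1) \<le> (real (2 * j + n - 1))\<^sup>2" "0 < 1 + real j * (real j + real n - 1)"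
proof -
  define k where "k = real n - 1"
  have k: "k \<ge> 1" using assms by (simp add: k_def)
  have q: "real (2 * j + n - 1) = 2 * real j + k" using assms by (simp add: k_def of_nat_diff)
  have "1 \<le> k\<^sup>2" using k by simp
  moreover have "0 \<le> real j * k" "0 \<le> real j * real j" using k by auto
  moreover have "(2 * real j + k)\<^sup>2 = 4 * (real j * real j) + 4 * (real j * k) + k\<^sup>2"
    by (simp add: power2_eq_square algebra_simps)
  moreover have "real j * (real j + real n - 1) = real j * real j + real j * k" by (simp add: k_def algebra_simps)
  ultimately show "1 + real j * (real j + real n - 1) \<le> (real (2 * j + n - 1))\<^sup>2" "0 < 1 + real j * (real j + real n - 1)"
    unfolding q by - linarith+
qed

text \<open>
  The common part of the two assertions; \<open>T\<close> is \<open>cos\<close> for \<open>e = 0\<close> and \<open>sin\<close> for \<open>e = 1\<close>. In both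
  cases the gain of \<open>e + 1\<close> derivatives allowed by the operator bound is only one more than the
  decay of the eigenvalues of order \<open>e\<close>, which leaves \<open>\<bar>T (q * \<beta> * pi / 2)\<bar> \<ge> const / q\<close> for
  \<open>q = 2 * j + n - 1\<close>. As \<open>T\<close> vanishes at the multiples \<open>p * (pi / 2)\<close> with \<open>p\<close> of the parity of \<open>u\<close>,
  the number \<open>q * \<beta>\<close> cannot be closer than that to such \<open>p\<close>. The values of \<open>q\<close> are the integers from
  \<open>n - 1\<close> on with the parity of \<open>n - 1\<close>.
\<close>

lemma bounded_inverse_imp_badly_approximable:
  fixes \<beta> :: real and u :: int and n e :: nat
  assumes dim: "DIM('a::euclidean_space) = n + 1" and n: "n \<ge> 2"
    and r: "0 < r"
    and bdd: "minkowski_funk_inverse_bounded TYPE('a) \<kappa> \<alpha> (cos (\<beta> * pi)) (s + real (e + 1)) s"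
    and eigenvalue: "\<And>j. minkowski_funk_eigenvalue \<kappa> n \<alpha> (cos (\<beta> * pi)) j * r * real (2 * j + n - 1) ^ e
      = \<kappa> \<alpha> (cos (\<beta> * pi)) * T (real (2 * j + n - 1) * (\<beta> * pi / 2))"
    and T: "\<And>x p. (even p \<longleftrightarrow> even u) \<Longrightarrow> \<bar>T x\<bar> \<le> \<bar>x - real_of_int p * (pi / 2)\<bar>"
  shows "\<beta> \<in> badly_approximable_of_parity (n - 1) u (int n - 1)"
proof -
  let ?m = "minkowski_funk_eigenvalue \<kappa> n \<alpha> (cos (\<beta> * pi))"
  define k where "k = \<bar>\<kappa> \<alpha> (cos (\<beta> * pi))\<bar>"
  obtain C where C: "C > 0" "\<And>j. ?m j \<noteq> 0"
    "\<And>j. 1 \<le> C * (1 + real j * (real j + real n - 1)) powr (real (e + 1) / 2) * \<bar>?m j\<bar>"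
    using minkowski_funk_inverse_bounded_imp_eigenvalue_bound[OF dim _ bdd] n by auto
  have k: "k > 0" using C(2)[of 0] by (auto simp: k_def minkowski_funk_eigenvalue_def)
  define K where "K = r / (C * k)"
  have K: "K > 0" using r C(1) k by (simp add: K_def)
  have lower: "K / real (2 * j + n - 1) \<le> \<bar>T (real (2 * j + n - 1) * (\<beta> * pi / 2))\<bar>" for j
  proof -
    define q where "q = real (2 * j + n - 1)"
    define l where "l = 1 + real j * (real j + real n - 1)"
    have q: "q > 0" using n by (simp add: q_def)
    have l: "0 < l" "l \<le> q powr 2"
      using Laplace_eigenvalue_le_square[OF n, of j] q unfolding l_def q_def
      by (simp_all only: powr_numeral)
    have "l powr (real (e + 1) / 2) \<le> (q powr 2) powr (real (e + 1) / 2)"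
      using l by (intro powr_mono2) auto
    also have "\<dots> = q powr (2 * (real (e + 1) / 2))" by (rule powr_powr)
    also have "2 * (real (e + 1) / 2) = real (e + 1)" by (simp add: field_simps)
    also have "q powr real (e + 1) = q * q ^ e" using q by (simp only: powr_realpow) simp
    finally have "C * l powr (real (e + 1) / 2) * \<bar>?m j\<bar> \<le> C * (q * q ^ e) * \<bar>?m j\<bar>"
      using C(1) by (intro mult_right_mono mult_left_mono) auto
    with C(3)[of j] have "1 \<le> C * (q * q ^ e) * \<bar>?m j\<bar>" unfolding l_def by linarith
    then have "r * 1 \<le> r * (C * (q * q ^ e) * \<bar>?m j\<bar>)" using r by (intro mult_left_mono) auto
    also have "\<dots> = C * q * \<bar>?m j * r * q ^ e\<bar>" using r q by (simp add: abs_mult)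
    also have "?m j * r * q ^ e = \<kappa> \<alpha> (cos (\<beta> * pi)) * T (q * (\<beta> * pi / 2))"
      unfolding q_def by (rule eigenvalue)
    also have "C * q * \<bar>\<dots>\<bar> = C * q * k * \<bar>T (q * (\<beta> * pi / 2))\<bar>" by (simp add: abs_mult k_def)
    finally have "K / q \<le> \<bar>T (q * (\<beta> * pi / 2))\<bar>" using C(1) q k by (simp add: field_simps K_def)
    then show ?thesis by (simp only: q_def)
  qed
  show ?thesis
    unfolding badly_approximable_of_parity_def
  proof (intro CollectI exI[of _ "K * (2 / pi)"] conjI allI impI)
    fix p q :: int
    assume pq: "int (n - 1) \<le> q \<and> 0 < q \<and> (even p \<longleftrightarrow> even u) \<and> (even q \<longleftrightarrow> even (int n - 1))"
    have "even (q - (int n - 1))" using pq by simp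
    then obtain i where i: "q - (int n - 1) = 2 * i" by (rule evenE)
    define j where "j = nat i"
    have "q = int (2 * j + n - 1)" using pq i n by (simp add: j_def)
    then have q: "real_of_int q = real (2 * j + n - 1)" by simp
    have "K / q \<le> \<bar>T (q * (\<beta> * pi / 2))\<bar>" unfolding q by (rule lower)
    also have "\<dots> \<le> \<bar>q * (\<beta> * pi / 2) - real_of_int p * (pi / 2)\<bar>" using pq by (intro T) simp
    also have "q * (\<beta> * pi / 2) - real_of_int p * (pi / 2) = (pi / 2) * (of_int q * \<beta> - of_int p)"
      by (simp add: algebra_simps)
    also have "\<bar>\<dots>\<bar> = (pi / 2) * \<bar>of_int q * \<beta> - of_int p\<bar>" by (simp add: abs_mult)
    finally have "(2 / pi) * (K / q) \<le> (2 / pi) * ((pi / 2) * \<bar>of_int q * \<beta> - of_int p\<bar>)"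
      by (intro mult_left_mono) auto
    then show "K * (2 / pi) / q \<le> \<bar>of_int q * \<beta> - of_int p\<bar>"
      by (simp add: mult.commute)
  qed (use K in simp)
qed

theorem theorem2p9:
  fixes n :: nat and \<kappa> :: "real \<Rightarrow> real \<Rightarrow> real"
  assumes "DIM('a::euclidean_space) = n + 1"
    and "n \<ge> 2"
    and "\<And>\<alpha> t. (\<forall>k::nat. \<alpha> \<noteq> - real n / 2 - real k) \<Longrightarrow> -1 < t \<Longrightarrow> t < 1 \<Longrightarrow> \<kappa> \<alpha> t \<noteq> 0"
  shows "(\<forall>s::real.
            {\<beta> \<in> {0<..<1::real}.
               minkowski_funk_inverse_bounded TYPE('a) \<kappa> ((1 - real n) / 2) (cos (\<beta> * pi)) (s + 1) s}
            \<in> null_sets lebesgue) \<and>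
         (even n \<longrightarrow> (\<forall>s::real.
            {\<beta> \<in> {0<..<1::real}.
               minkowski_funk_inverse_bounded TYPE('a) \<kappa> ((3 - real n) / 2) (cos (\<beta> * pi)) (s + 2) s}
            \<in> null_sets lebesgue))"
proof -
  let ?Bad = "\<lambda>u. badly_approximable_of_parity (n - 1) u (int n - 1)"
  \<comment> \<open>For \<open>u = 1\<close> the parity class is never (even, even); for \<open>u = 0\<close> this is where \<open>n\<close> has to be even.\<close>
  have null: "S \<in> null_sets lebesgue" if "S \<subseteq> ?Bad u" "odd u \<or> odd (int n - 1)" for S u
    using negligible_subset[OF negligible_badly_approximable_of_given_parity[OF that(2)]] that(1)
    by (simp add: negligible_iff_null_sets)
  have "\<beta> \<in> ?Bad 1"
    if \<beta>: "0 < \<beta>" "\<beta> < 1"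
      and bdd: "minkowski_funk_inverse_bounded TYPE('a) \<kappa> ((1 - real n) / 2) (cos (\<beta> * pi)) (s + 1) s" for \<beta> s
  proof (rule bounded_inverse_imp_badly_approximable[OF assms(1,2), where e = 0 and T = cos])
    show "0 < cos (\<beta> * pi / 2)" using \<beta> by (auto intro!: cos_gt_zero)
    show "\<bar>cos x\<bar> \<le> \<bar>x - real_of_int p * (pi / 2)\<bar>" if "even p \<longleftrightarrow> even (1::int)" for x p
      using that by (intro abs_cos_le_dist_odd_multiple_half_pi) simp
  qed (use bdd minkowski_funk_eigenvalue_cos[OF assms(2) \<beta>] in simp_all)
  moreover have "\<beta> \<in> ?Bad 0"
    if \<beta>: "0 < \<beta>" "\<beta> < 1"
      and bdd: "minkowski_funk_inverse_bounded TYPE('a) \<kappa> ((3 - real n) / 2) (cos (\<beta> * pi)) (s + 2) s" for \<beta> s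
  proof (rule bounded_inverse_imp_badly_approximable[OF assms(1,2), where e = 1 and T = sin])
    show "0 < sin (\<beta> * pi / 2)" using \<beta> by (auto intro!: sin_gt_zero)
    show "\<bar>sin x\<bar> \<le> \<bar>x - real_of_int p * (pi / 2)\<bar>" if par: "even p \<longleftrightarrow> even (0::int)" for x p
    proof -
      obtain i where "p = 2 * i" using par by (auto elim: evenE)
      then show ?thesis using abs_sin_le_dist_multiple_pi[of x i] by simp
    qed
  qed (use bdd minkowski_funk_eigenvalue_sin[OF assms(2) \<beta>] in simp_all)
  ultimately show ?thesis
    by (intro conjI allI impI null) auto
qed

end
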